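(* For $p\in[0,1]$ let $v_\infty(p)$ be the limit value of the percolation Markov decision process (PMDP) on $\mathbb{Z}^2$ with action set $I=\{e_1,e_2\}$, $e_1=(1,0)$, $e_2=(0,1)$, and i.i.d. $\mathrm{Bernoulli}(p)$ payoffs, with the token starting at the origin. Let $\vec p_{bc}$ be the critical probability of oriented Bernoulli percolation on $\mathbb{Z}_+\times\mathbb{Z}_+$. Then $$v_\infty(p)=1\ \ \mathbb{P}\text{-a.s.}\quad\text{if and only if}\quad p\ge\vec p_{bc}.$$
   Context: A PMDP on $\mathbb{Z}^d$ is a tuple $(I,\mathcal{E},g)$ where $I\subset\mathbb{Z}^d$ is a non-empty finite set (the action set), $\mathcal{E}=(\Omega,\mathscr{F},\mathbb{P})$ is a probability space, and $g=\{\omega\mapsto g_\omega(z,i)\}_{(z,i)\in\mathbb{Z}^d\times I}$ is a collection of uniformly bounded, i.i.d. real-valued random variables on $\Omega$. Let $\mathcal{F}_{\mathrm{all}}=\sigma(\{\omega\mapsto g_\omega(z,i): z\in\mathbb{Z}^d,i\in I\})$. A strategy is a sequence $\sigma=(\sigma_m)_{m\ge1}$ of mappings $\sigma_m:\Omega\times\mathbb{Z}^d\to I$, each measurable with respect to $\mathcal{F}_{\mathrm{all}}\otimes\mathcal{P}(\mathbb{Z}^d)$; $\Sigma$ is the set of strategies. Given an initial state $z$ and $\omega$, $\sigma$ induces the play $z_1=z$, $i_m=\sigma_m(\omega,z)$, $z_{m+1}=z_m+i_m$ for $m\ge1$. The $n$-stage payoff is $\gamma_n^\omega(z,\sigma)=\frac1n\sum_{m=1}^n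 g_\omega(z_m,i_m)$ and the $n$-stage value is $v_n^\omega(z)=\max_{\sigma\in\Sigma}\gamma_n^\omega(z,\sigma)$. For this PMDP, $v_n(z)$ converges $\mathbb{P}$-a.s. as $n\to\infty$ to a deterministic constant independent of $z$, the limit value $v_\infty(p)$. Oriented Bernoulli percolation on $\mathbb{Z}_+\times\mathbb{Z}_+$ (where $\mathbb{Z}_+=\{0,1,2,\dots\}$): directed edges run from each $x$ to $x+e_1$ and $x+e_2$; each edge is open with probability $p$ and closed with probability $1-p$, independently of all other edges (law $\mathbb{P}_p$). An infinite oriented open path is a sequence $(x_k)_{k\in\mathbb{N}}$ in $\mathbb{Z}_+\times\mathbb{Z}_+$ with $x_{k+1}-x_k\in\{e_1,e_2\}$ and all edges $(x_k,x_{k+1})$ open. The critical probability is $$\vec p_{bc}:=\inf\{p\in[0,1]:\mathbb{P}_p(\text{there exists an infinite oriented open path})=1\}.$$ It is known that $\vec p_{bc}\in(0,1)$. *)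

theory Defs
  imports "HOL-Probability.Probability"
begin

section \<open>Percolation Markov decision processes on \<open>\<int>\<^sup>d\<close>\<close>

locale PMDP = prob_space M
  for M :: "'w measure" +
  fixes I :: "(int ^ 'd) set"
    and g :: "'w \<Rightarrow> int ^ 'd \<Rightarrow> int ^ 'd \<Rightarrow> real"
  assumes finite_actions: "finite I"
    and nonempty_actions: "I \<noteq> {}"
    and uniformly_bounded: "\<exists>B. \<forall>\<omega>\<in>space M. \<forall>z. \<forall>i\<in>I. \<bar>g \<omega> z i\<bar> \<le> B"
    and independent_payoffs: "indep_vars (\<lambda>_. borel) (\<lambda>(z, i) \<omega>. g \<omega> z i) (UNIV \<times> I)"
    and identically_distributed:
      "\<And>z i z' i'. i \<in> I \<Longrightarrow> i' \<in> I \<Longrightarrow>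
         distr M borel (\<lambda>\<omega>. g \<omega> z i) = distr M borel (\<lambda>\<omega>. g \<omega> z' i')"
begin

text \<open>The \<open>\<sigma>\<close>-algebra \<open>\<F>\<^sub>a\<^sub>l\<^sub>l\<close> generated by all payoff variables.\<close>

definition F_all :: "'w measure" where
  "F_all = sigma (space M)
     {(\<lambda>\<omega>. g \<omega> z i) -` B \<inter> space M | z i B. i \<in> I \<and> B \<in> sets borel}"

text \<open>Stages are counted from 0: \<open>\<sigma> m\<close> is the decision rule of stage \<open>m + 1\<close>, and
  \<open>state \<sigma> \<omega> z m\<close> is \<open>z\<^sub>m\<^sub>+\<^sub>1\<close>.\<close>

definition strategies :: "(nat \<Rightarrow> 'w \<Rightarrow> int ^ 'd \<Rightarrow> int ^ 'd) set" where
  "strategies = {\<sigma>. \<forall>m. (\<lambda>(\<omega>, z). \<sigma> m \<omega> z) \<in>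
     F_all \<Otimes>\<^sub>M count_space UNIV \<rightarrow>\<^sub>M count_space I}"

primrec state :: "(nat \<Rightarrow> 'w \<Rightarrow> int ^ 'd \<Rightarrow> int ^ 'd) \<Rightarrow> 'w \<Rightarrow> int ^ 'd \<Rightarrow> nat \<Rightarrow> int ^ 'd" where
  "state \<sigma> \<omega> z 0 = z"
| "state \<sigma> \<omega> z (Suc m) = state \<sigma> \<omega> z m + \<sigma> m \<omega> (state \<sigma> \<omega> z m)"

definition payoff ::
  "nat \<Rightarrow> 'w \<Rightarrow> int ^ 'd \<Rightarrow> (nat \<Rightarrow> 'w \<Rightarrow> int ^ 'd \<Rightarrow> int ^ 'd) \<Rightarrow> real" where
  "payoff n \<omega> z \<sigma> =
     (\<Sum>m<n. g \<omega> (state \<sigma> \<omega> z m) (\<sigma> m \<omega> (state \<sigma> \<omega> z m))) / real n"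

text \<open>For \<open>\<omega>\<close> in the sample space the set of payoffs is finite, since the first \<open>n\<close> actions
  range over the finite set \<open>I\<close>, so the maximum is a genuine one.\<close>

definition stage_value :: "nat \<Rightarrow> 'w \<Rightarrow> int ^ 'd \<Rightarrow> real" where
  "stage_value n \<omega> z = (MAX \<sigma>\<in>strategies. payoff n \<omega> z \<sigma>)"

definition limit_value :: real where
  "limit_value = (THE v. \<forall>z. AE \<omega> in M. (\<lambda>n. stage_value n \<omega> z) \<longlonglongrightarrow> v)"

end

definition e1 :: "int ^ 2" where "e1 = axis 1 1"

definition e2 :: "int ^ 2" where "e2 = axis 2 1"


section \<open>Oriented Bernoulli percolation on the quadrant\<close>

definition oriented_edges :: "((nat \<times> nat) \<times> (nat \<times> nat)) set" where
  "oriented_edges = {(x, y). y = x + (1, 0) \<or> y = x + (0, 1)}"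

text \<open>A configuration assigns \<open>True\<close> to the open edges.\<close>

definition percolation :: "real \<Rightarrow> ((nat \<times> nat) \<times> (nat \<times> nat) \<Rightarrow> bool) measure" where
  "percolation p = (\<Pi>\<^sub>M e\<in>oriented_edges. measure_pmf (bernoulli_pmf p))"

text \<open>Paths may start at any vertex.\<close>

definition infinite_open_path ::
  "((nat \<times> nat) \<times> (nat \<times> nat) \<Rightarrow> bool) \<Rightarrow> (nat \<Rightarrow> nat \<times> nat) \<Rightarrow> bool" where
  "infinite_open_path \<omega> x \<longleftrightarrow>
     (\<forall>k. (x k, x (Suc k)) \<in> oriented_edges \<and> \<omega> (x k, x (Suc k)))"

definition critical_probability :: real where
  "critical_probability = Inf {p \<in> {0..1}.
     measure (percolation p)
       {\<omega> \<in> space (percolation p). \<exists>x. infinite_open_path \<omega> x} = 1}"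

end

theory Submission
  imports Defs
begin

text \<open>
  Let \<open>a\<^sub>n(p)\<close> be the expected maximal number of open edges on an oriented path of length \<open>n\<close>. It is
  superadditive, and the maximum concentrates around its mean, so that the limit value of the
  decision process is the speed \<open>v(p) = lim a\<^sub>n(p) / n\<close>.

  If percolation occurs at \<open>q\<close>, then following an infinite open path gives \<open>v(q) = 1\<close>. The speed is
  monotone, and opening each closed edge with probability \<open>d\<close> raises it by at most \<open>v(d)\<close>, which
  tends to 0 with \<open>d\<close>; hence \<open>v = 1\<close> also at the critical probability.

  Conversely, if \<open>v(p) = 1\<close>, then at any \<open>r > p\<close> the \<open>o(n)\<close> closed edges of an optimal path are all
  opened with probability \<open>exp(-o(n))\<close>, so the crossing probabilities do not decay exponentially at \<open>r\<close>.
  By the argument of Duminil-Copin and Tassion, \<open>phi r S \<ge> 1\<close> then holds for every finite \<open>S\<close> that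
  contains the origin, and integrating the resulting differential inequality bounds the crossing
  probabilities from below at every larger parameter. Kolmogorov's 0-1 law gives percolation there.
\<close>

text \<open>Whether infinite paths exist at the critical probability itself is never decided. The
  closed inequality \<open>p \<ge> critical_probability\<close> therefore cannot come from
  percolation at \<open>p\<close>; it rests on right-continuity of the speed. This needs only that
  the passage value is subadditive under sprinkling and that few open edges give a small speed: the
  \<open>2\<^sup>n\<close> paths cannot make up for the rarity of open edges.

  In the converse the parameter rises twice, once to sprinkle and once to integrate. Both rises can
  be made arbitrarily small, and the critical probability is an infimum, so nothing is lost.

  Up to the passage to infinite paths, all estimates concern finite edge sets, where expectations
  are polynomials in the parameter. Couplings become identities between iterated sums, independence
  is a product formula, and Russo's formula is the derivative of a finite sum. Measure theory enters
  only through Borel--Cantelli, continuity from above and the 0-1 law.\<close>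

section \<open>Expectations over finite Bernoulli configurations\<close>

text \<open>Expectation over a random subset of \<open>E\<close> with density \<open>p\<close>, as a
  polynomial in \<open>p\<close>. The identities below hold for every real \<open>p\<close>; only
  the inequalities ask for \<open>0 \<le> p\<close> and \<open>p \<le> 1\<close>.\<close>

definition config_mean :: "real \<Rightarrow> 'a set \<Rightarrow> ('a set \<Rightarrow> real) \<Rightarrow> real" where
  "config_mean p E f = (\<Sum>A\<in>Pow E. p ^ card A * (1 - p) ^ card (E - A) * f A)"

lemma config_mean_empty [simp]: "config_mean p {} f = f {}"
  by (simp add: config_mean_def)

text \<open>Conditioning on the state of the single edge \<open>e\<close>. Constants, disjoint
  unions, preimages, sprinkling and Russo's formula all follow from it by induction on the edge
  set.\<close>

lemma config_mean_insert:
  assumes "finite E" "e \<notin> E"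
  shows "config_mean p (insert e E) f = p * config_mean p E (\<lambda>A. f (insert e A)) + (1 - p) * config_mean p E f"
proof -
  have inj: "inj_on (insert e) (Pow E)"
    using assms(2) by (auto intro!: inj_onI dest: insert_ident[THEN iffD1, rotated 2])
  have "config_mean p (insert e E) f =
      (\<Sum>A\<in>Pow E. p ^ card A * (1 - p) ^ card (insert e E - A) * f A) +
      (\<Sum>A\<in>insert e ` Pow E. p ^ card A * (1 - p) ^ card (insert e E - A) * f A)"
    unfolding config_mean_def Pow_insert using assms by (intro sum.union_disjoint) auto
  also have "(\<Sum>A\<in>Pow E. p ^ card A * (1 - p) ^ card (insert e E - A) * f A) = (1 - p) * config_mean p E f"
    unfolding config_mean_def sum_distrib_left
  proof (intro sum.cong refl)
    fix A assume "A \<in> Pow E"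
    then have "insert e E - A = insert e (E - A)" "e \<notin> E - A" "finite (E - A)"
      using assms by auto
    then have "card (insert e E - A) = Suc (card (E - A))"
      by simp
    then show "p ^ card A * (1 - p) ^ card (insert e E - A) * f A =
        (1 - p) * (p ^ card A * (1 - p) ^ card (E - A) * f A)"
      by simp
  qed
  also have "(\<Sum>A\<in>insert e ` Pow E. p ^ card A * (1 - p) ^ card (insert e E - A) * f A) =
      p * config_mean p E (\<lambda>A. f (insert e A))"
    unfolding config_mean_def sum_distrib_left sum.reindex[OF inj] o_def
  proof (intro sum.cong refl)
    fix A assume "A \<in> Pow E"
    then have "insert e E - insert e A = E - A" "e \<notin> A" "finite A"
      using assms by (auto intro: finite_subset)
    then show "p ^ card (insert e A) * (1 - p) ^ card (insert e E - insert e A) * f (insert e A) =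
        p * (p ^ card A * (1 - p) ^ card (E - A) * f (insert e A))"
      by simp
  qed
  finally show ?thesis
    by simp
qed

lemma config_mean_cong: "(\<And>A. A \<subseteq> E \<Longrightarrow> f A = f' A) \<Longrightarrow> config_mean p E f = config_mean p E f'"
  unfolding config_mean_def by (intro sum.cong) auto

lemma config_mean_mono:
  assumes "0 \<le> p" "p \<le> 1" "\<And>A. A \<subseteq> E \<Longrightarrow> f A \<le> f' A"
  shows "config_mean p E f \<le> config_mean p E f'"
  unfolding config_mean_def using assms by (intro sum_mono mult_left_mono) auto

lemma config_mean_add: "config_mean p E (\<lambda>A. f A + f' A) = config_mean p E f + config_mean p E f'"
  unfolding config_mean_def by (simp add: distrib_left sum.distrib)

lemma config_mean_cmult: "config_mean p E (\<lambda>A. c * f A) = c * config_mean p E f"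
  unfolding config_mean_def by (simp add: sum_distrib_left ac_simps)

lemma config_mean_diff: "config_mean p E (\<lambda>A. f A - f' A) = config_mean p E f - config_mean p E f'"
  unfolding config_mean_def by (simp add: right_diff_distrib sum_subtractf)

lemma config_mean_sum: "config_mean p E (\<lambda>A. \<Sum>i\<in>I. f i A) = (\<Sum>i\<in>I. config_mean p E (f i))"
  unfolding config_mean_def sum_distrib_left by (rule sum.swap)

lemma config_mean_const [simp]: "finite E \<Longrightarrow> config_mean p E (\<lambda>_. c) = c"
  by (induction E rule: finite_induct) (simp_all add: config_mean_insert algebra_simps)

lemma config_mean_nonneg:
  assumes "0 \<le> p" "p \<le> 1" "\<And>A. A \<subseteq> E \<Longrightarrow> 0 \<le> f A"
  shows "0 \<le> config_mean p E f"
  unfolding config_mean_def using assms by (intro sum_nonneg mult_nonneg_nonneg) auto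

lemma config_mean_Un:
  assumes "finite E" "finite E'" "E \<inter> E' = {}"
  shows "config_mean p (E \<union> E') f = config_mean p E (\<lambda>A. config_mean p E' (\<lambda>B. f (A \<union> B)))"
  using assms
proof (induction E arbitrary: f rule: finite_induct)
  case (insert e E)
  then have "e \<notin> E \<union> E'" "finite (E \<union> E')" "E \<inter> E' = {}"
    by auto
  then show ?case
    using insert by (simp add: config_mean_insert)
qed simp

text \<open>The edges of \<open>E\<close> are integrated in two blocks, those in \<open>K\<close>
  and the others. Only the first block affects \<open>f\<close> and only the second affects
  \<open>f'\<close>, so the double sum factorises.\<close>

lemma config_mean_indep:
  assumes "finite E" "K \<inter> L = {}"
    and f: "\<And>A. f A = f (A \<inter> K)" and f': "\<And>A. f' A = f' (A \<inter> L)"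
  shows "config_mean p E (\<lambda>A. f A * f' A) = config_mean p E f * config_mean p E f'"
proof -
  have split: "config_mean p E h = config_mean p (E \<inter> K) (\<lambda>A. config_mean p (E - K) (\<lambda>B. h (A \<union> B)))" for h
  proof -
    have "E \<inter> K \<union> (E - K) = E" "E \<inter> K \<inter> (E - K) = {}"
      by auto
    then show ?thesis
      using config_mean_Un[of "E \<inter> K" "E - K" p h] assms(1) by simp
  qed
  have fA: "f (A \<union> B) = f A" if "A \<subseteq> E \<inter> K" "B \<subseteq> E - K" for A B
  proof -
    have "(A \<union> B) \<inter> K = A \<inter> K"
      using that by auto
    then show ?thesis
      using f[of "A \<union> B"] f[of A] by simp
  qed
  have fB: "f' (A \<union> B) = f' B" if "A \<subseteq> E \<inter> K" "B \<subseteq> E - K" for A B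
  proof -
    have "(A \<union> B) \<inter> L = B \<inter> L"
      using that assms(2) by auto
    then show ?thesis
      using f'[of "A \<union> B"] f'[of B] by simp
  qed
  have fin: "finite (E \<inter> K)" "finite (E - K)"
    using assms(1) by auto
  have "config_mean p E (\<lambda>A. f A * f' A) = config_mean p (E \<inter> K) (\<lambda>A. config_mean p (E - K) (\<lambda>B. f A * f' B))"
    unfolding split[of "\<lambda>A. f A * f' A"] by (intro config_mean_cong) (simp add: fA fB)
  also have "\<dots> = config_mean p (E \<inter> K) f * config_mean p (E - K) f'"
    by (simp add: config_mean_cmult) (simp add: mult.commute[of _ "config_mean p (E - K) f'"] config_mean_cmult)
  also have "config_mean p (E \<inter> K) f = config_mean p E f"
  proof -
    have "config_mean p E f = config_mean p (E \<inter> K) (\<lambda>A. config_mean p (E - K) (\<lambda>B. f A))"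
      unfolding split[of f] by (intro config_mean_cong) (simp add: fA)
    with fin show ?thesis by simp
  qed
  also have "config_mean p (E - K) f' = config_mean p E f'"
  proof -
    have "config_mean p E f' = config_mean p (E \<inter> K) (\<lambda>A. config_mean p (E - K) (\<lambda>B. f' B))"
      unfolding split[of f'] by (intro config_mean_cong) (simp add: fB)
    with fin show ?thesis by simp
  qed
  finally show ?thesis .
qed

lemma config_mean_superset:
  assumes "finite E'" "E \<subseteq> E'" "\<And>A. f A = f (A \<inter> E)"
  shows "config_mean p E' f = config_mean p E f"
proof -
  have "config_mean p E' f = config_mean p (E \<union> (E' - E)) f"
    using assms(2) by (simp add: Un_absorb1)
  also have "\<dots> = config_mean p E (\<lambda>A. config_mean p (E' - E) (\<lambda>B. f (A \<union> B)))"
    using assms by (intro config_mean_Un) (auto intro: finite_subset)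
  also have "\<dots> = config_mean p E (\<lambda>A. config_mean p (E' - E) (\<lambda>B. f A))"
  proof (intro config_mean_cong)
    fix A B assume "A \<subseteq> E" "B \<subseteq> E' - E"
    then have "(A \<union> B) \<inter> E = A \<inter> E"
      by auto
    then show "f (A \<union> B) = f A"
      using assms(3)[of "A \<union> B"] assms(3)[of A] by simp
  qed
  finally show ?thesis
    using assms(1) by simp
qed

text \<open>Used with \<open>h = shift z\<close> as translation invariance. Edges outside the range
  of \<open>h\<close> do not influence the preimage and integrate out, so injectivity
  suffices.\<close>

lemma config_mean_vimage:
  assumes "finite E" "inj h"
  shows "config_mean p E (\<lambda>A. f (h -` A)) = config_mean p (h -` E) f"
  using assms(1)
proof (induction E arbitrary: f rule: finite_induct)
  case (insert e E)
  have fin: "finite (h -` E)"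
    using insert.hyps(1) assms(2) by (intro finite_vimageI)
  show ?case
  proof (cases "\<exists>d. h d = e")
    case True
    then obtain d where d: "h d = e" by blast
    have ins: "h -` insert e A = insert d (h -` A)" for A
      using d assms(2) by (auto dest: injD)
    have "d \<notin> h -` E"
      using d insert.hyps(2) by auto
    then show ?thesis
      using insert.IH[of f] insert.IH[of "\<lambda>A. f (insert d A)"] insert.hyps fin
      by (simp add: config_mean_insert ins)
  next
    case False
    then have "h -` insert e A = h -` A" for A
      by auto
    then show ?thesis
      using insert by (simp add: config_mean_insert algebra_simps)
  qed
qed simp

text \<open>In the union of independent configurations of densities \<open>p\<close> and
  \<open>d\<close>, an edge is open with probability \<open>1 - (1 - p) * (1 - d)\<close>. This
  identity replaces the coupling of different parameters.\<close>

lemma config_mean_sprinkle: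
  assumes "finite E"
  shows "config_mean (p + (1 - p) * d) E f = config_mean p E (\<lambda>A. config_mean d E (\<lambda>B. f (A \<union> B)))"
  using assms
proof (induction E arbitrary: f rule: finite_induct)
  case (insert e E)
  show ?case
    using insert.hyps
    by (simp add: config_mean_insert insert.IH config_mean_add config_mean_cmult) (simp add: algebra_simps)
qed simp

lemma config_mean_subset:
  assumes "finite E" "D \<subseteq> E"
  shows "config_mean p E (\<lambda>A. of_bool (D \<subseteq> A)) = p ^ card D"
proof -
  have "config_mean p D (\<lambda>A. of_bool (D \<subseteq> A)) = (\<Sum>A\<in>{D}. p ^ card A * (1 - p) ^ card (D - A) * of_bool (D \<subseteq> A))"
    unfolding config_mean_def using finite_subset[OF assms(2,1)] by (intro sum.mono_neutral_right) auto
  moreover have "config_mean p E (\<lambda>A. of_bool (D \<subseteq> A)) = config_mean p D (\<lambda>A. of_bool (D \<subseteq> A))"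
    using assms by (intro config_mean_superset) auto
  ultimately show ?thesis
    by simp
qed

text \<open>Product rule along \<open>config_mean_insert\<close>. For the indicator of an increasing
  event, the summand of \<open>e\<close> is the probability that \<open>e\<close> is
  pivotal.\<close>

lemma russo_formula:
  assumes "finite E"
  shows "((\<lambda>p. config_mean p E f) has_real_derivative
    (\<Sum>e\<in>E. config_mean p E (\<lambda>A. f (insert e A) - f (A - {e})))) (at p)"
  using assms
proof (induction E arbitrary: f rule: finite_induct)
  case (insert e E)
  let ?D = "\<lambda>f. \<Sum>d\<in>E. config_mean p E (\<lambda>A. f (insert d A) - f (A - {d}))"
  have deriv: "((\<lambda>p. p * config_mean p E (\<lambda>A. f (insert e A)) + (1 - p) * config_mean p E f) has_real_derivative
     (config_mean p E (\<lambda>A. f (insert e A)) + p * ?D (\<lambda>A. f (insert e A))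
      + (- config_mean p E f + (1 - p) * ?D f))) (at p)"
    by (rule derivative_eq_intros insert.IH refl | simp)+
  have "config_mean p (insert e E) (\<lambda>A. f (insert d A) - f (A - {d})) =
     p * config_mean p E (\<lambda>A. f (insert e (insert d A)) - f (insert e (A - {d})))
     + (1 - p) * config_mean p E (\<lambda>A. f (insert d A) - f (A - {d}))" if "d \<in> E" for d
  proof -
    have "d \<noteq> e" using that insert.hyps by auto
    then have "insert e A - {d} = insert e (A - {d})" for A
      by auto
    then show ?thesis
      using insert.hyps by (simp add: config_mean_insert insert_commute)
  qed
  then have "(\<Sum>d\<in>E. config_mean p (insert e E) (\<lambda>A. f (insert d A) - f (A - {d}))) =
      p * ?D (\<lambda>A. f (insert e A)) + (1 - p) * ?D f"
    by (simp add: sum.distrib sum_distrib_left)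
  moreover have "config_mean p (insert e E) (\<lambda>A. f (insert e A) - f (A - {e})) =
      config_mean p E (\<lambda>A. f (insert e A)) - config_mean p E f"
  proof -
    have "config_mean p E (\<lambda>A. f (A - {e})) = config_mean p E f"
      using insert.hyps by (intro config_mean_cong) (auto intro!: arg_cong[of _ _ f])
    then show ?thesis
      using insert.hyps by (simp add: config_mean_insert config_mean_diff algebra_simps)
  qed
  ultimately have "(\<Sum>d\<in>insert e E. config_mean p (insert e E) (\<lambda>A. f (insert d A) - f (A - {d}))) =
      config_mean p E (\<lambda>A. f (insert e A)) + p * ?D (\<lambda>A. f (insert e A))
      + (- config_mean p E f + (1 - p) * ?D f)"
    unfolding sum.insert[OF insert.hyps] by linarith
  with deriv show ?case
    by (simp only: config_mean_insert[OF insert.hyps, of _ f])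
qed simp

section \<open>Last passage values and the speed\<close>

definition level :: "nat \<times> nat \<Rightarrow> nat" where
  "level x = fst x + snd x"

lemma level_add [simp]: "level (x + y) = level x + level y"
  by (simp add: level_def)

lemma level_simps [simp]: "level (1, 0) = 1" "level (0, 1) = 1" "level (0, Suc 0) = 1" "level (Suc 0, 0) = 1" "level 0 = 0"
  by (simp_all add: level_def zero_prod_def)

lemma finite_level: "finite {x. level x < n}"
proof (rule finite_subset)
  show "{x. level x < n} \<subseteq> {..<n} \<times> {..<n}"
    by (auto simp: level_def)
qed auto

definition slab :: "nat \<Rightarrow> ((nat \<times> nat) \<times> (nat \<times> nat)) set" where
  "slab n = {e \<in> oriented_edges. level (fst e) < n}"

definition layer :: "nat \<Rightarrow> ((nat \<times> nat) \<times> (nat \<times> nat)) set" where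
  "layer l = {e \<in> oriented_edges. level (fst e) = l}"

lemma edgeI [intro, simp]: "(x, x + (1, 0)) \<in> oriented_edges" "(x, x + (0, 1)) \<in> oriented_edges"
  by (simp_all add: oriented_edges_def)

lemma edge_level: "(x, y) \<in> oriented_edges \<Longrightarrow> level y = Suc (level x)"
  by (auto simp: oriented_edges_def)

lemma finite_oriented_edges_on:
  assumes "finite S"
  shows "finite {e \<in> oriented_edges. fst e \<in> S}"
proof (rule finite_subset)
  show "{e \<in> oriented_edges. fst e \<in> S} \<subseteq> (\<lambda>x. (x, x + (1, 0))) ` S \<union> (\<lambda>x. (x, x + (0, 1))) ` S"
    by (auto simp: oriented_edges_def image_iff)
qed (use assms in auto)

lemma finite_slab [simp]: "finite (slab n)"
  using finite_oriented_edges_on[OF finite_level[of n]] by (simp add: slab_def)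

lemma finite_layer [simp]: "finite (layer n)"
  by (rule finite_subset[OF _ finite_slab[of "Suc n"]]) (auto simp: slab_def layer_def)

lemma slab_0 [simp]: "slab 0 = {}"
  by (simp add: slab_def)

lemma slab_Suc: "slab (Suc n) = slab n \<union> layer n" and slab_layer_disjoint: "slab n \<inter> layer n = {}"
  by (auto simp: slab_def layer_def)

definition shift :: "nat \<times> nat \<Rightarrow> (nat \<times> nat) \<times> (nat \<times> nat) \<Rightarrow> (nat \<times> nat) \<times> (nat \<times> nat)" where
  "shift z e = (z + fst e, z + snd e)"

lemma inj_shift: "inj (shift z)"
  by (auto simp: inj_def shift_def)

lemma shift_edge_iff: "shift z e \<in> oriented_edges \<longleftrightarrow> e \<in> oriented_edges"
  by (cases e) (auto simp: shift_def oriented_edges_def add.assoc)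

lemma shift_vimage_slab: "shift z -` slab (level z + n) = slab n"
  by (auto simp: slab_def shift_edge_iff) (auto simp: shift_def)

text \<open>Recursion on the first step avoids representing paths. Closed edges may be traversed and
  merely score 0. The value iteration of the decision process, \<open>total_value\<close>, has the
  same shape.\<close>

fun passage :: "((nat \<times> nat) \<times> (nat \<times> nat)) set \<Rightarrow> nat \<Rightarrow> nat \<times> nat \<Rightarrow> nat" where
  "passage A 0 x = 0"
| "passage A (Suc n) x = max (of_bool ((x, x + (1, 0)) \<in> A) + passage A n (x + (1, 0)))
                             (of_bool ((x, x + (0, 1)) \<in> A) + passage A n (x + (0, 1)))"

lemma passage_le: "passage A n x \<le> n"
  by (induction n arbitrary: x) (auto simp: of_bool_def intro: le_SucI)

lemma passage_mono: "A \<subseteq> A' \<Longrightarrow> passage A n x \<le> passage A' n x"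
proof (induction n arbitrary: x)
  case (Suc n)
  have "of_bool (e \<in> A) \<le> (of_bool (e \<in> A') :: nat)" for e
    using Suc.prems by auto
  then show ?case
    using Suc by (simp only: passage.simps) (intro max.mono add_mono; blast)
qed simp

text \<open>A path that is optimal for the union scores each of its edges in \<open>A\<close> or in
  \<open>A'\<close>. This subadditivity bounds the gain from sprinkling by the speed of the
  sprinkled edges alone.\<close>

lemma passage_Un_le: "passage (A \<union> A') n x \<le> passage A n x + passage A' n x"
proof (induction n arbitrary: x)
  case (Suc n)
  have "of_bool (e \<in> A \<union> A') + passage (A \<union> A') n y \<le>
      (of_bool (e \<in> A) + passage A n y) + (of_bool (e \<in> A') + passage A' n y)" for e y
    using Suc[of y] by auto
  from this[of "(x, x + (1, 0))" "x + (1, 0)"] this[of "(x, x + (0, 1))" "x + (0, 1)"] show ?case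
    by (simp only: passage.simps)
qed simp

lemma passage_shift: "passage A n (z + x) = passage (shift z -` A) n x"
  by (induction n arbitrary: x) (simp_all add: shift_def add.assoc)

lemma passage_cong:
  assumes "A \<inter> {e \<in> oriented_edges. level x \<le> level (fst e) \<and> level (fst e) < level x + n} =
           A' \<inter> {e \<in> oriented_edges. level x \<le> level (fst e) \<and> level (fst e) < level x + n}"
  shows "passage A n x = passage A' n x"
  using assms
proof (induction n arbitrary: x)
  case (Suc n)
  have eq: "passage A n y = passage A' n y" if "level y = Suc (level x)" for y
  proof (rule Suc.IH)
    let ?Q = "\<lambda>x n. {e \<in> oriented_edges. level x \<le> level (fst e) \<and> level (fst e) < level x + n}"
    have Q: "?Q y n = ?Q x (Suc n) \<inter> ?Q y n"
      using that by auto
    have "A \<inter> ?Q y n = (A \<inter> ?Q x (Suc n)) \<inter> ?Q y n"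
      by (subst Q) (rule Int_assoc[symmetric])
    also have "\<dots> = A' \<inter> ?Q y n"
      unfolding Suc.prems by (subst (2) Q) (rule Int_assoc)
    finally show "A \<inter> ?Q y n = A' \<inter> ?Q y n" .
  qed
  have mem: "(x, y) \<in> A \<longleftrightarrow> (x, y) \<in> A'" if "(x, y) \<in> oriented_edges" for y
    using eqset_imp_iff[OF Suc.prems, of "(x, y)"] that by simp
  show ?case
    by (simp only: passage.simps mem[OF edgeI(1)] mem[OF edgeI(2)]
        eq[OF edge_level[OF edgeI(1)]] eq[OF edge_level[OF edgeI(2)]])
qed simp

lemma passage_Int_slab:
  assumes "level x + n \<le> m"
  shows "passage A n x = passage (A \<inter> slab m) n x"
  by (rule passage_cong) (use assms in \<open>auto simp: slab_def\<close>)

text \<open>Levels increase strictly along a path, so it meets \<open>layer l\<close> at most once,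
  and never if it starts above it.\<close>

lemma passage_layer_le: "passage (layer l) n x \<le> of_bool (level x \<le> l)"
proof (induction n arbitrary: x)
  case (Suc n)
  have "of_bool ((x, y) \<in> layer l) + passage (layer l) n y \<le> of_bool (level x \<le> l)"
    if "level y = Suc (level x)" for y
    using Suc[of y] that by (cases "(x, y) \<in> layer l") (auto simp: layer_def of_bool_def split: if_splits)
  from this[of "x + (1, 0)"] this[of "x + (0, 1)"] show ?case
    by simp
qed simp

text \<open>\<open>y\<close> is the end of an optimal path for \<open>A\<close>. It is chosen before
  \<open>m\<close> and \<open>D\<close>, so that the edges above can be averaged while
  \<open>y\<close> stays fixed.\<close>

lemma passage_split:
  "\<exists>y. level y = level x + n \<and> (\<forall>m D. passage A n x + passage D m y \<le> passage (A \<union> D) (n + m) x)"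
proof (induction n arbitrary: x)
  case 0
  show ?case
    using passage_mono[of _ "A \<union> _"] by (intro exI[of _ x]) simp
next
  case (Suc n)
  have "\<exists>x'. (x' = x + (1, 0) \<or> x' = x + (0, 1)) \<and>
      passage A (Suc n) x = of_bool ((x, x') \<in> A) + passage A n x'"
    by (simp only: passage.simps max_def) metis
  then obtain x' where x': "x' = x + (1, 0) \<or> x' = x + (0, 1)"
    and eq: "passage A (Suc n) x = of_bool ((x, x') \<in> A) + passage A n x'"
    by blast
  from Suc[of x'] obtain y where y: "level y = level x' + n"
    "\<And>m D. passage A n x' + passage D m y \<le> passage (A \<union> D) (n + m) x'"
    by blast
  have "passage A (Suc n) x + passage D m y \<le> passage (A \<union> D) (Suc n + m) x" for m D
  proof -
    have "passage A (Suc n) x + passage D m y \<le> of_bool ((x, x') \<in> A \<union> D) + passage (A \<union> D) (n + m) x'"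
      unfolding eq using y(2)[of D m] by auto
    also have "\<dots> \<le> passage (A \<union> D) (Suc n + m) x"
      using x' by auto
    finally show ?thesis .
  qed
  with y(1) x' show ?case
    by (intro exI[of _ y]) auto
qed

section \<open>Superadditivity and the speed as a limit\<close>

definition mean_passage :: "real \<Rightarrow> nat \<Rightarrow> real" where
  "mean_passage p n = config_mean p (slab n) (\<lambda>A. real (passage A n 0))"

lemma config_mean_passage_vertex:
  assumes "level x + n \<le> m"
  shows "config_mean p (slab m) (\<lambda>A. f (passage A n x)) = config_mean p (slab n) (\<lambda>A. f (passage A n 0))"
proof -
  have "config_mean p (slab m) (\<lambda>A. f (passage A n x)) = config_mean p (slab (level x + n)) (\<lambda>A. f (passage A n x))"
  proof (rule config_mean_superset)
    show "f (passage A n x) = f (passage (A \<inter> slab (level x + n)) n x)" for A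
      using passage_Int_slab[of x n "level x + n" A] by simp
    show "slab (level x + n) \<subseteq> slab m"
      using assms by (auto simp: slab_def)
  qed simp
  also have "\<dots> = config_mean p (slab (level x + n)) (\<lambda>A. f (passage (shift x -` A) n 0))"
    using passage_shift[of _ n x 0] by simp
  also have "\<dots> = config_mean p (slab n) (\<lambda>A. f (passage A n 0))"
    by (subst config_mean_vimage[OF finite_slab inj_shift, where f = "\<lambda>A. f (passage A n 0)"])
      (simp add: shift_vimage_slab)
  finally show ?thesis .
qed

lemma mean_passage_nonneg: "0 \<le> p \<Longrightarrow> p \<le> 1 \<Longrightarrow> 0 \<le> mean_passage p n"
  unfolding mean_passage_def by (rule config_mean_nonneg) auto

lemma mean_passage_le:
  assumes "0 \<le> p" "p \<le> 1"
  shows "mean_passage p n \<le> real n"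
proof -
  have "mean_passage p n \<le> config_mean p (slab n) (\<lambda>_. real n)"
    unfolding mean_passage_def using assms by (intro config_mean_mono) (auto simp: passage_le)
  then show ?thesis
    by simp
qed

text \<open>Freeze the edges below level \<open>n\<close>: they determine the end \<open>y\<close>
  of an optimal first piece. The edges of \<open>?R\<close> are independent of it, and an optimal
  continuation from \<open>y\<close> has mean score \<open>mean_passage p m\<close> by translation
  invariance.\<close>

lemma mean_passage_superadditive:
  assumes "0 \<le> p" "p \<le> 1"
  shows "mean_passage p n + mean_passage p m \<le> mean_passage p (n + m)"
proof -
  let ?R = "slab (n + m) - slab n"
  have slab: "slab (n + m) = slab n \<union> ?R"
    by (auto simp: slab_def)
  have "config_mean p ?R (\<lambda>D. real (passage (A \<union> D) (n + m) 0)) \<ge> real (passage A n 0) + mean_passage p m" for A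
  proof -
    obtain y where y: "level y = n" "\<And>D. passage A n 0 + passage D m y \<le> passage (A \<union> D) (n + m) 0"
      using passage_split[of 0 n A] by auto
    have "config_mean p ?R (\<lambda>D. real (passage D m y)) = config_mean p (slab (n + m)) (\<lambda>D. real (passage D m y))"
    proof (rule config_mean_superset[symmetric])
      show "real (passage D m y) = real (passage (D \<inter> ?R) m y)" for D
        using y(1) by (intro arg_cong[where f = real] passage_cong) (auto simp: slab_def)
    qed auto
    also have "\<dots> = mean_passage p m"
      unfolding mean_passage_def by (rule config_mean_passage_vertex[where f = real]) (simp add: y(1))
    finally have "real (passage A n 0) + mean_passage p m = config_mean p ?R (\<lambda>D. real (passage A n 0) + real (passage D m y))"
      by (simp add: config_mean_add)
    also have "\<dots> \<le> config_mean p ?R (\<lambda>D. real (passage (A \<union> D) (n + m) 0))"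
      using y(2) assms by (intro config_mean_mono) (auto simp flip: of_nat_add)
    finally show ?thesis .
  qed
  then have "config_mean p (slab n) (\<lambda>A. real (passage A n 0) + mean_passage p m) \<le>
      config_mean p (slab n) (\<lambda>A. config_mean p ?R (\<lambda>D. real (passage (A \<union> D) (n + m) 0)))"
    using assms by (intro config_mean_mono)
  also have "\<dots> = config_mean p (slab n \<union> ?R) (\<lambda>A. real (passage A (n + m) 0))"
    by (rule config_mean_Un[symmetric]) auto
  finally show ?thesis
    using slab by (simp add: mean_passage_def config_mean_add)
qed

text \<open>By superadditivity (Fekete's lemma) the supremum is also the limit, see
  \<open>mean_passage_tendsto_speed\<close>. As a supremum it bounds the means at every finite
  \<open>n\<close> without an error term.\<close>

definition speed :: "real \<Rightarrow> real" where
  "speed p = (SUP n\<in>{1..}. mean_passage p n / real n)"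

context
  fixes p :: real
  assumes p: "0 \<le> p" "p \<le> 1"
begin

lemma bdd_above_mean_passage: "bdd_above ((\<lambda>n. mean_passage p n / real n) ` {1..})"
proof (rule bdd_aboveI2)
  fix n :: nat assume "n \<in> {1..}"
  then show "mean_passage p n / real n \<le> 1"
    using mean_passage_le[OF p, of n] by (simp add: divide_le_eq)
qed

lemma mean_passage_le_speed: "mean_passage p n \<le> real n * speed p"
proof (cases "n = 0")
  case False
  then have "mean_passage p n / real n \<le> speed p"
    unfolding speed_def by (intro cSUP_upper bdd_above_mean_passage) auto
  then show ?thesis
    using False by (simp add: divide_le_eq mult.commute)
qed (use mean_passage_le[OF p, of 0] in simp)

lemma speed_le: 
  assumes "\<And>n. n \<ge> 1 \<Longrightarrow> mean_passage p n \<le> c * real n"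
  shows "speed p \<le> c"
  unfolding speed_def using assms by (intro cSUP_least) (auto simp: divide_le_eq mult.commute)

lemma speed_le_1: "speed p \<le> 1"
  using mean_passage_le[OF p] by (intro speed_le) simp

lemma mean_passage_mult: "real k * mean_passage p m \<le> mean_passage p (k * m)"
proof (induction k)
  case (Suc k)
  then show ?case
    using mean_passage_superadditive[OF p, of m "k * m"] by (simp add: algebra_simps)
qed (simp add: mean_passage_nonneg[OF p])

lemma mean_passage_tendsto_speed: "(\<lambda>n. mean_passage p n / real n) \<longlonglongrightarrow> speed p"
proof (rule LIMSEQ_I)
  fix r :: real assume r: "0 < r"
  obtain m :: nat where m: "m \<ge> 1" "speed p - r / 2 < mean_passage p m / real m"
    using less_cSUP_iff[OF _ bdd_above_mean_passage, of "speed p - r / 2"] r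
    by (auto simp: speed_def)
  \<comment> \<open>Cutting \<open>n\<close> into blocks of length \<open>m\<close> loses at most
    \<open>m\<close> in the remainder, which is below \<open>n * (r / 2)\<close> once
    \<open>n > N\<close>.\<close>
  obtain N :: nat where N: "real N \<ge> 2 * real m / r"
    using real_arch_simple by blast
  show "\<exists>N. \<forall>n\<ge>N. norm (mean_passage p n / real n - speed p) < r"
  proof (intro exI allI impI)
    fix n assume n: "n \<ge> Suc N"
    define b where "b = mean_passage p m / real m"
    have b: "b \<le> 1" "0 \<le> b"
      using m mean_passage_le[OF p, of m] mean_passage_nonneg[OF p, of m]
      by (simp_all add: b_def divide_le_eq)
    have n_eq: "n div m * m + n mod m = n"
      by simp
    have "real m * b = mean_passage p m"
      using m by (simp add: b_def)
    then have "real (n div m * m) * b \<le> mean_passage p (n div m * m)"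
      using mean_passage_mult[of "n div m" m] by (simp only: of_nat_mult mult.assoc)
    also have "\<dots> \<le> mean_passage p n"
      using mean_passage_superadditive[OF p, of "n div m * m" "n mod m"]
        mean_passage_nonneg[OF p, of "n mod m"] n_eq by simp
    finally have "real (n div m * m) * b \<le> mean_passage p n" .
    moreover have "real (n div m * m) * b \<ge> real n * b - real m"
    proof -
      have "real n = real (n div m * m) + real (n mod m)"
        using n_eq by (metis of_nat_add)
      moreover have "n mod m < m"
        using m by simp
      then have "real (n mod m) * b \<le> real m * 1"
        using b by (intro mult_mono) auto
      ultimately show ?thesis
        by (simp only: distrib_right)
    qed
    ultimately have "real n * b - real m \<le> mean_passage p n"
      by linarith
    moreover have "real m < real n * (r / 2)"
    proof -
      have "real m * 2 \<le> real N * r"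
        using N r by (simp add: divide_le_eq mult.commute)
      also have "\<dots> < real n * r"
        using n r by (intro mult_strict_right_mono) auto
      finally show ?thesis by simp
    qed
    ultimately have "real n * (b - r / 2) < mean_passage p n"
      by (simp add: algebra_simps)
    then have "b - r / 2 < mean_passage p n / real n"
      using n by (simp add: less_divide_eq mult.commute)
    moreover have "mean_passage p n / real n \<le> speed p"
      using n mean_passage_le_speed[of n] by (simp add: divide_le_eq mult.commute)
    ultimately show "norm (mean_passage p n / real n - speed p) < r"
      using m r by (simp add: b_def abs_if)
  qed
qed

section \<open>Dependence of the speed on the parameter\<close>

lemma mean_passage_sprinkle:
  assumes d: "0 \<le> d" "d \<le> 1"
  shows "mean_passage p n \<le> mean_passage (p + (1 - p) * d) n"
    and "mean_passage (p + (1 - p) * d) n \<le> mean_passage p n + mean_passage d n"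
proof -
  have eq: "mean_passage (p + (1 - p) * d) n =
      config_mean p (slab n) (\<lambda>A. config_mean d (slab n) (\<lambda>B. real (passage (A \<union> B) n 0)))"
    unfolding mean_passage_def by (rule config_mean_sprinkle) simp
  have "config_mean p (slab n) (\<lambda>A. config_mean d (slab n) (\<lambda>B. real (passage A n 0))) \<le> mean_passage (p + (1 - p) * d) n"
    unfolding eq using p d by (intro config_mean_mono) (auto intro: passage_mono)
  then show "mean_passage p n \<le> mean_passage (p + (1 - p) * d) n"
    by (simp add: mean_passage_def)
  have "mean_passage (p + (1 - p) * d) n \<le>
      config_mean p (slab n) (\<lambda>A. config_mean d (slab n) (\<lambda>B. real (passage A n 0) + real (passage B n 0)))"
    unfolding eq using p d by (intro config_mean_mono) (auto intro: passage_Un_le simp flip: of_nat_add)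
  then show "mean_passage (p + (1 - p) * d) n \<le> mean_passage p n + mean_passage d n"
    by (simp add: mean_passage_def config_mean_add)
qed

end

lemma speed_sprinkle:
  assumes p: "0 \<le> p" "p \<le> 1" and d: "0 \<le> d" "d \<le> 1"
  shows "speed p \<le> speed (p + (1 - p) * d)"
    and "speed (p + (1 - p) * d) \<le> speed p + speed d"
proof -
  have q: "0 \<le> p + (1 - p) * d" "p + (1 - p) * d \<le> 1"
    using p d mult_left_le[of d "1 - p"] by auto
  show "speed p \<le> speed (p + (1 - p) * d)"
    using mean_passage_sprinkle(1)[OF p d]
    by (intro LIMSEQ_le[OF mean_passage_tendsto_speed[OF p] mean_passage_tendsto_speed[OF q]])
      (auto intro!: divide_right_mono exI[of _ 0])
  show "speed (p + (1 - p) * d) \<le> speed p + speed d"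
    using mean_passage_sprinkle(2)[OF p d]
    by (intro LIMSEQ_le[OF mean_passage_tendsto_speed[OF q]
        tendsto_add[OF mean_passage_tendsto_speed[OF p] mean_passage_tendsto_speed[OF d]]])
      (auto intro!: divide_right_mono exI[of _ 0] simp flip: add_divide_distrib)
qed

lemma speed_mono: 
  assumes "0 \<le> p" "p \<le> q" "q \<le> 1"
  shows "speed p \<le> speed q"
proof (cases "p = 1")
  case False
  then have "q = p + (1 - p) * ((q - p) / (1 - p))" "(q - p) / (1 - p) \<le> 1" "0 \<le> (q - p) / (1 - p)"
    using assms by (auto simp: divide_simps)
  then show ?thesis
    using speed_sprinkle(1)[of p "(q - p) / (1 - p)"] assms by simp
qed (use assms in simp)

lemma speed_1 [simp]: "speed 1 = 1"
proof -
  have full: "passage (slab m) n x = n" if "level x + n \<le> m" for m n x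
    using that
  proof (induction n arbitrary: x)
    case (Suc n)
    then have "(x, y) \<in> slab m" "passage (slab m) n y = n" if "(x, y) \<in> oriented_edges" for y
      using edge_level[OF that] that Suc by (auto simp: slab_def)
    from this[OF edgeI(1)] this[OF edgeI(2)] show ?case
      by (simp only: passage.simps) simp
  qed simp
  have "mean_passage 1 n = real n" for n
  proof -
    have "config_mean 1 (slab n) (\<lambda>A. real (passage A n 0)) =
       (\<Sum>A\<in>{slab n}. 1 ^ card A * (1 - 1) ^ card (slab n - A) * real (passage A n 0))"
      unfolding config_mean_def by (intro sum.mono_neutral_right) (auto simp: card_gt_0_iff power_0_left)
    then show ?thesis
      by (simp add: mean_passage_def full)
  qed
  then have "(\<lambda>n. mean_passage 1 n / real n) = (\<lambda>n. real n / real n)"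
    by simp
  moreover have "(\<lambda>n. real n / real n) \<longlonglongrightarrow> 1"
    by (rule tendsto_eventually) (auto intro!: eventually_sequentiallyI[of 1])
  ultimately show ?thesis
    using LIMSEQ_unique[OF mean_passage_tendsto_speed[of 1]] by simp
qed

text \<open>A union bound over the \<open>2\<^sup>n\<close> paths, in exponential moments.\<close>

lemma config_mean_exp_passage_le:
  assumes "0 \<le> d" "d \<le> 1" "level x + n \<le> m"
  shows "config_mean d (slab m) (\<lambda>A. exp (t * real (passage A n x))) \<le> (2 * (1 - d + d * exp t)) ^ n"
  using assms(3)
proof (induction n arbitrary: x)
  case (Suc n)
  have step: "config_mean d (slab m) (\<lambda>A. exp (t * real (of_bool ((x, y) \<in> A) + passage A n y))) \<le>
      (1 - d + d * exp t) * (2 * (1 - d + d * exp t)) ^ n"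
    if "(x, y) \<in> oriented_edges" for y
  proof -
    have "config_mean d (slab m) (\<lambda>A. exp (t * real (of_bool ((x, y) \<in> A) + passage A n y))) =
       config_mean d (slab m) (\<lambda>A. exp (t * of_bool ((x, y) \<in> A)) * exp (t * real (passage A n y)))"
      by (simp add: distrib_left exp_add)
    also have "\<dots> = config_mean d (slab m) (\<lambda>A. exp (t * of_bool ((x, y) \<in> A))) *
       config_mean d (slab m) (\<lambda>A. exp (t * real (passage A n y)))"
    \<comment> \<open>Later edges start at a higher level, so the path from \<open>y\<close> never
      meets \<open>(x, y)\<close> again.\<close>
    proof (rule config_mean_indep[where K = "{(x, y)}" and L = "- {(x, y)}"])
      show "exp (t * real (passage A n y)) = exp (t * real (passage (A \<inter> - {(x, y)}) n y))" for A
        using edge_level[OF that] by (intro arg_cong[where f = "\<lambda>n. exp (t * real n)"] passage_cong) auto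
    qed auto
    also have "config_mean d (slab m) (\<lambda>A. exp (t * of_bool ((x, y) \<in> A))) =
       config_mean d {(x, y)} (\<lambda>A. exp (t * of_bool ((x, y) \<in> A)))"
      using that Suc.prems finite_slab[of m] by (intro config_mean_superset) (auto simp: slab_def)
    also have "\<dots> = 1 - d + d * exp t"
      by (simp add: config_mean_insert)
    also have "(1 - d + d * exp t) * config_mean d (slab m) (\<lambda>A. exp (t * real (passage A n y))) \<le>
        (1 - d + d * exp t) * (2 * (1 - d + d * exp t)) ^ n"
      using assms Suc.prems edge_level[OF that] by (intro mult_left_mono Suc.IH) auto
    finally show ?thesis .
  qed
  \<comment> \<open>The maximum under \<open>exp\<close> is bounded by the sum over both first
    steps, which is the source of the factor 2.\<close>
  have "config_mean d (slab m) (\<lambda>A. exp (t * real (passage A (Suc n) x))) \<le>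
     config_mean d (slab m) (\<lambda>A. exp (t * real (of_bool ((x, x + (1, 0)) \<in> A) + passage A n (x + (1, 0)))) +
        exp (t * real (of_bool ((x, x + (0, 1)) \<in> A) + passage A n (x + (0, 1)))))"
    using assms by (intro config_mean_mono) (simp_all only: passage.simps max_def, auto)
  also have "\<dots> \<le> (1 - d + d * exp t) * (2 * (1 - d + d * exp t)) ^ n +
      (1 - d + d * exp t) * (2 * (1 - d + d * exp t)) ^ n"
    unfolding config_mean_add by (intro add_mono step edgeI)
  finally show ?case
    by (simp add: algebra_simps)
qed simp

text \<open>Jensen's inequality for \<open>exp\<close>, in the form in which the exponent of the mean is bounded.\<close>

lemma config_mean_le_of_exp:
  assumes "finite E" "0 \<le> p" "p \<le> 1" "config_mean p E (\<lambda>A. exp (f A)) \<le> exp c"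
  shows "config_mean p E f \<le> c"
proof -
  have "config_mean p E (\<lambda>A. 1 + (f A - c)) \<le> config_mean p E (\<lambda>A. exp (f A - c))"
    using assms by (intro config_mean_mono exp_ge_add_one_self) auto
  also have "\<dots> = config_mean p E (\<lambda>A. exp (- c) * exp (f A))"
    by (simp add: exp_diff exp_minus field_simps)
  also have "\<dots> \<le> exp (- c) * exp c"
    unfolding config_mean_cmult using assms by (intro mult_left_mono) auto
  also have "\<dots> = 1"
    by (simp add: exp_minus)
  finally show ?thesis
    using assms(1) by (simp add: config_mean_add config_mean_diff)
qed

text \<open>The logarithm of the exponential moment per step, divided by \<open>t\<close>:
  \<open>ln 2\<close> is the entropy of the paths, and \<open>d * exp t\<close> bounds the log
  moment of a single edge.\<close>

lemma speed_le_ln: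
  assumes "0 \<le> d" "d \<le> 1" "t > 0"
  shows "speed d \<le> (ln 2 + d * exp t) / t"
proof (rule speed_le)
  fix n :: nat
  have pos: "0 < 2 * (1 - d + d * exp t)"
  proof -
    have "0 < (1 - d) * 1 + d * exp t"
      using assms by (cases "d = 0") (auto intro: add_nonneg_pos)
    then show ?thesis by simp
  qed
  have "exp (real n * ln (2 * (1 - d + d * exp t))) = (2 * (1 - d + d * exp t)) ^ n"
    using pos by (simp only: exp_of_nat_mult exp_ln)
  then have "config_mean d (slab n) (\<lambda>A. exp (t * real (passage A n 0))) \<le> exp (real n * ln (2 * (1 - d + d * exp t)))"
    using config_mean_exp_passage_le[of d 0 n n t] assms by simp
  then have "config_mean d (slab n) (\<lambda>A. t * real (passage A n 0)) \<le> real n * ln (2 * (1 - d + d * exp t))"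
    by (rule config_mean_le_of_exp[OF finite_slab assms(1,2)])
  then have "t * mean_passage d n \<le> real n * ln (2 * (1 - d + d * exp t))"
    by (simp add: mean_passage_def config_mean_cmult)
  also have "ln (2 * (1 - d + d * exp t)) = ln 2 + ln (1 - d + d * exp t)"
    using pos by (intro ln_mult_pos) auto
  also have "ln (1 - d + d * exp t) \<le> d * exp t"
    using ln_le_minus_one[of "1 - d + d * exp t"] pos assms by auto
  finally have "t * mean_passage d n \<le> real n * (ln 2 + d * exp t)"
    by (simp add: mult_left_mono)
  then show "mean_passage d n \<le> (ln 2 + d * exp t) / t * real n"
    using assms by (simp add: field_simps)
qed (use assms in auto)

lemma speed_small:
  assumes "e > 0"
  shows "\<exists>d>0. d \<le> 1 \<and> speed d < e"
proof -
  \<comment> \<open>A large \<open>t\<close> makes the entropy term \<open>ln 2 / t\<close> small,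
    and \<open>d\<close> is then chosen to give \<open>d * exp t = 1 / 2\<close>. As
    \<open>ln 2 + 1 / 2 < 2\<close>, the quotient stays below \<open>e\<close>.\<close>
  define t where "t = 2 / e"
  define d where "d = exp (- t) / 2"
  have t: "t > 0"
    using assms by (simp add: t_def)
  have d: "0 < d" "d \<le> 1"
    using t by (auto simp: d_def intro: order_trans[of _ "exp 0"])
  have "d * exp t = 1 / 2"
    by (simp add: d_def exp_minus)
  with speed_le_ln[of d t] d t have "speed d \<le> (ln 2 + 1 / 2) / t"
    by (simp only:)
  also have "\<dots> < 2 / t"
    using t ln_2_less_1 by (intro divide_strict_right_mono) auto
  also have "\<dots> = e"
    using assms by (simp add: t_def)
  finally show ?thesis
    using d by blast
qed

section \<open>Concentration of the passage value around its mean\<close>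

lemma exp_le_one_plus_quadratic:
  fixes x :: real
  assumes "\<bar>x\<bar> \<le> 1"
  shows "exp x \<le> 1 + x + x\<^sup>2"
proof (cases "x \<ge> 0")
  case True
  then show ?thesis
    using assms exp_bound[of x] by simp
next
  case False
  define y where "y = - x"
  have y: "0 < y" "y \<le> 1"
    using False assms by (auto simp: y_def)
  have "exp x = 1 / exp y"
    by (simp add: y_def exp_minus divide_inverse)
  also have "\<dots> \<le> 1 / (1 + y)"
    using y exp_ge_add_one_self[of y] by (intro divide_left_mono) auto
  also have "\<dots> \<le> 1 - y + y\<^sup>2"
  proof -
    have "(1 - y + y\<^sup>2) * (1 + y) = 1 + y ^ 3"
      by (simp add: algebra_simps power2_eq_square power3_eq_cube)
    then show ?thesis
      using y by (simp add: divide_le_eq)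
  qed
  finally show ?thesis
    by (simp add: y_def)
qed

lemma config_mean_abs_le:
  assumes "finite E" "0 \<le> p" "p \<le> 1" "\<And>A. A \<subseteq> E \<Longrightarrow> \<bar>f A\<bar> \<le> c"
  shows "\<bar>config_mean p E f\<bar> \<le> c"
proof -
  have "config_mean p E f \<le> config_mean p E (\<lambda>_. c)" "config_mean p E (\<lambda>_. - c) \<le> config_mean p E f"
    using assms(2-4) by (auto intro!: config_mean_mono simp: abs_le_iff minus_le_iff)
  then show ?thesis
    using assms(1) by (simp add: abs_le_iff)
qed

text \<open>A crude Hoeffding lemma: the linear term is centred and averages to 0, and the quadratic
  one is at most \<open>t\<^sup>2\<close>. The constant is not optimised, since only summability
  over \<open>n\<close> is asked for later.\<close>

lemma config_mean_exp_centered_le: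
  assumes "finite E" "0 \<le> p" "p \<le> 1" "\<bar>t\<bar> \<le> 1"
    and osc: "\<And>A B. A \<subseteq> E \<Longrightarrow> B \<subseteq> E \<Longrightarrow> \<bar>f A - f B\<bar> \<le> 1"
  shows "config_mean p E (\<lambda>A. exp (t * (f A - config_mean p E f))) \<le> exp (t\<^sup>2)"
proof -
  have dev: "\<bar>f A - config_mean p E f\<bar> \<le> 1" if "A \<subseteq> E" for A
    using config_mean_abs_le[of E p "\<lambda>B. f A - f B" 1] assms that by (simp add: config_mean_diff)
  have "config_mean p E (\<lambda>A. exp (t * (f A - config_mean p E f))) \<le> config_mean p E (\<lambda>A. 1 + t * (f A - config_mean p E f) + t\<^sup>2)"
  proof (intro config_mean_mono assms)
    fix A assume "A \<subseteq> E"
    then have d: "\<bar>f A - config_mean p E f\<bar> \<le> 1"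
      by (rule dev)
    then have "\<bar>t * (f A - config_mean p E f)\<bar> \<le> 1"
      using assms(4) by (simp add: abs_mult mult_le_one)
    then have "exp (t * (f A - config_mean p E f)) \<le> 1 + t * (f A - config_mean p E f) + t\<^sup>2 * (f A - config_mean p E f)\<^sup>2"
      using exp_le_one_plus_quadratic[of "t * (f A - config_mean p E f)"] by (simp add: power_mult_distrib)
    also have "t\<^sup>2 * (f A - config_mean p E f)\<^sup>2 \<le> t\<^sup>2"
      using d by (intro mult_left_le) (auto simp: abs_square_le_1)
    finally show "exp (t * (f A - config_mean p E f)) \<le> 1 + t * (f A - config_mean p E f) + t\<^sup>2"
      by simp
  qed
  also have "\<dots> = 1 + t\<^sup>2"
    using assms(1) by (simp add: config_mean_add config_mean_cmult config_mean_diff)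
  also have "\<dots> \<le> exp (t\<^sup>2)"
    by (rule exp_ge_add_one_self)
  finally show ?thesis .
qed

lemma config_mean_slab_Suc: "config_mean p (slab (Suc n)) f = config_mean p (slab n) (\<lambda>A. config_mean p (layer n) (\<lambda>B. f (A \<union> B)))"
  unfolding slab_Suc by (rule config_mean_Un) (auto simp: slab_layer_disjoint)

text \<open>The martingale method: the layers are integrated out one at a time.\<close>

lemma config_mean_slab_exp_centered_le:
  assumes "0 \<le> p" "p \<le> 1" "\<bar>t\<bar> \<le> 1"
    and "\<And>l A B. l < n \<Longrightarrow> A - layer l = B - layer l \<Longrightarrow> \<bar>f A - f B\<bar> \<le> 1"
  shows "config_mean p (slab n) (\<lambda>A. exp (t * (f A - config_mean p (slab n) f))) \<le> exp (real n * t\<^sup>2)"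
  using assms(4)
proof (induction n arbitrary: f)
  case (Suc n)
  \<comment> \<open>\<open>h\<close> averages out the top layer. The difference between
    \<open>f\<close> and \<open>h\<close> contributes the factor \<open>exp (t\<^sup>2)\<close>, and
    \<open>h\<close> inherits the bounded differences in the lower layers, so that the induction
    applies to it.\<close>
  define h where "h A = config_mean p (layer n) (\<lambda>B. f (A \<union> B))" for A
  have mean: "config_mean p (slab (Suc n)) f = config_mean p (slab n) h"
    by (simp add: config_mean_slab_Suc h_def[abs_def])
  have inner: "config_mean p (layer n) (\<lambda>B. exp (t * (f (A \<union> B) - h A))) \<le> exp (t\<^sup>2)" for A
    unfolding h_def using assms(1-3)
    by (intro config_mean_exp_centered_le) (auto intro!: Suc.prems[of n])
  have "config_mean p (slab (Suc n)) (\<lambda>A. exp (t * (f A - config_mean p (slab n) h))) =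
      config_mean p (slab n) (\<lambda>A. exp (t * (h A - config_mean p (slab n) h)) *
        config_mean p (layer n) (\<lambda>B. exp (t * (f (A \<union> B) - h A))))"
    by (simp add: config_mean_slab_Suc algebra_simps flip: config_mean_cmult exp_add)
  also have "\<dots> \<le> config_mean p (slab n) (\<lambda>A. exp (t * (h A - config_mean p (slab n) h)) * exp (t\<^sup>2))"
    using assms(1,2) inner by (intro config_mean_mono mult_left_mono) auto
  also have "\<dots> = exp (t\<^sup>2) * config_mean p (slab n) (\<lambda>A. exp (t * (h A - config_mean p (slab n) h)))"
    by (simp add: mult.commute flip: config_mean_cmult)
  also have "\<dots> \<le> exp (t\<^sup>2) * exp (real n * t\<^sup>2)"
  proof (intro mult_left_mono Suc.IH)
    fix l A B assume l: "l < n" and AB: "A - layer l = B - layer l"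
    have "\<bar>config_mean p (layer n) (\<lambda>C. f (A \<union> C) - f (B \<union> C))\<bar> \<le> 1"
    proof (rule config_mean_abs_le)
      fix C
      have "(A \<union> C) - layer l = (B \<union> C) - layer l"
        using AB by auto
      then show "\<bar>f (A \<union> C) - f (B \<union> C)\<bar> \<le> 1"
        using l by (intro Suc.prems) auto
    qed (use assms in auto)
    then show "\<bar>h A - h B\<bar> \<le> 1"
      by (simp add: h_def config_mean_diff)
  qed auto
  finally show ?case
    by (simp add: mean algebra_simps flip: exp_add)
qed simp

text \<open>Each of \<open>A\<close> and \<open>B\<close> is covered by the other together with the
  layer, and the layer adds at most 1. These are the bounded differences of the martingale
  method.\<close>

lemma passage_layer_osc:
  assumes "A - layer l = B - layer l"
  shows "\<bar>real (passage A n x) - real (passage B n x)\<bar> \<le> 1"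
proof -
  have "passage A n x \<le> passage B n x + 1" if "A \<subseteq> B \<union> layer l" for A B
  proof -
    have "passage A n x \<le> passage B n x + passage (layer l) n x"
      using passage_mono[OF that, of n x] passage_Un_le[of B "layer l" n x] by simp
    also have "passage (layer l) n x \<le> 1"
      by (rule order_trans[OF passage_layer_le]) simp
    finally show ?thesis by simp
  qed
  moreover have "A \<subseteq> B \<union> layer l" "B \<subseteq> A \<union> layer l"
    using assms by blast+
  ultimately have "passage A n x \<le> passage B n x + 1" "passage B n x \<le> passage A n x + 1"
    by blast+
  then show ?thesis
    by linarith
qed

lemma passage_deviation:
  assumes p: "0 \<le> p" "p \<le> 1" and e: "0 < e" "e \<le> 1"
  shows "config_mean p (slab n) (\<lambda>A. of_bool (e * real n \<le> \<bar>real (passage A n 0) - mean_passage p n\<bar>))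
    \<le> 2 * exp (- (e\<^sup>2 / 4)) ^ n"
proof -
  \<comment> \<open>Minimises the exponent \<open>n * t\<^sup>2 - t * e * n\<close> of the Chernoff
    bound, with minimum \<open>- n * e\<^sup>2 / 4\<close>; \<open>e \<le> 1\<close> keeps
    \<open>t\<close> in the range of the moment bound.\<close>
  define t where "t = e / 2"
  have t: "0 \<le> t" "t \<le> 1"
    using e by (auto simp: t_def)
  define u where "u A = real (passage A n 0) - mean_passage p n" for A
  have mom: "config_mean p (slab n) (\<lambda>A. exp (s * u A)) \<le> exp (real n * t\<^sup>2)" if "s = t \<or> s = - t" for s
  proof -
    have "config_mean p (slab n) (\<lambda>A. exp (s * u A)) \<le> exp (real n * s\<^sup>2)"
      unfolding u_def mean_passage_def using p t that
      by (intro config_mean_slab_exp_centered_le passage_layer_osc) auto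
    then show ?thesis
      using that by auto
  qed
  have "config_mean p (slab n) (\<lambda>A. of_bool (e * real n \<le> \<bar>u A\<bar>)) \<le>
      config_mean p (slab n) (\<lambda>A. exp (- (t * e * real n)) * (exp (t * u A) + exp (- t * u A)))"
  proof (intro config_mean_mono p)
    fix A :: "((nat \<times> nat) \<times> (nat \<times> nat)) set"
    show "of_bool (e * real n \<le> \<bar>u A\<bar>) \<le> exp (- (t * e * real n)) * (exp (t * u A) + exp (- t * u A))"
    proof (cases "e * real n \<le> \<bar>u A\<bar>")
      case True
      then have "t * (e * real n) \<le> t * \<bar>u A\<bar>"
        using t by (intro mult_left_mono)
      then have "1 \<le> exp (- (t * e * real n)) * exp (t * \<bar>u A\<bar>)"
        by (simp flip: exp_add)
      also have "\<dots> \<le> exp (- (t * e * real n)) * (exp (t * u A) + exp (- t * u A))"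
        by (intro mult_left_mono) (auto simp: abs_if)
      finally show ?thesis
        using True by simp
    next
      case False
      then show ?thesis by (simp add: add_nonneg_nonneg)
    qed
  qed
  also have "\<dots> \<le> exp (- (t * e * real n)) * (exp (real n * t\<^sup>2) + exp (real n * t\<^sup>2))"
    unfolding config_mean_cmult config_mean_add using mom[of t] mom[of "- t"] by (intro mult_left_mono add_mono) auto
  also have "\<dots> = 2 * exp (real n * (- (e\<^sup>2 / 4)))"
    by (simp add: t_def power2_eq_square algebra_simps flip: exp_add)
  also have "\<dots> = 2 * exp (- (e\<^sup>2 / 4)) ^ n"
    by (simp only: exp_of_nat_mult)
  finally show ?thesis
    by (simp add: u_def)
qed

section \<open>Sharpness of the phase transition\<close>

text \<open>With \<open>n \<le> level y\<close> in place of equality, the relation is antitone in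
  \<open>n\<close> for every \<open>A\<close>, and a vertex at level \<open>n\<close> or above
  satisfies it trivially.\<close>

definition reaches :: "((nat \<times> nat) \<times> (nat \<times> nat)) set \<Rightarrow> nat \<times> nat \<Rightarrow> nat \<Rightarrow> bool" where
  "reaches A x n \<longleftrightarrow> (\<exists>y. n \<le> level y \<and> (x, y) \<in> A\<^sup>*)"

lemma reachesI [intro]: "n \<le> level x \<Longrightarrow> reaches A x n"
  unfolding reaches_def by blast

lemma reaches_mono: "reaches A x n \<Longrightarrow> A \<subseteq> B \<Longrightarrow> m \<le> n \<Longrightarrow> reaches B x m"
  unfolding reaches_def by (meson rtrancl_mono subsetD order_trans)

lemma reaches_step: "(x, y) \<in> A \<Longrightarrow> reaches A y n \<Longrightarrow> reaches A x n"
  unfolding reaches_def by (meson converse_rtrancl_into_rtrancl)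

lemma reaches_rtrancl: "(x, y) \<in> A\<^sup>* \<Longrightarrow> reaches A y n \<Longrightarrow> reaches A x n"
  unfolding reaches_def by (meson rtrancl_trans)

lemma reaches_Int_slab:
  assumes "A \<subseteq> oriented_edges"
  shows "reaches (A \<inter> slab n) x n \<longleftrightarrow> reaches A x n"
proof
  assume "reaches A x n"
  then obtain y where "(x, y) \<in> A\<^sup>*" "n \<le> level y"
    unfolding reaches_def by blast
  then show "reaches (A \<inter> slab n) x n"
  proof (induction rule: converse_rtrancl_induct)
    case (step u v)
    then show ?case
    proof (cases "n \<le> level u")
      case False
      then have "(u, v) \<in> A \<inter> slab n"
        using step.hyps(1) assms by (auto simp: slab_def)
      then show ?thesis
        using step.IH[OF step.prems] by (rule reaches_step)
    qed blast
  qed blast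
qed (auto intro: reaches_mono)

lemma reaches_Suc_iff:
  assumes "A \<subseteq> oriented_edges" "level x < n"
  shows "reaches A x n \<longleftrightarrow> (x, x + (1, 0)) \<in> A \<and> reaches A (x + (1, 0)) n \<or>
     (x, x + (0, 1)) \<in> A \<and> reaches A (x + (0, 1)) n"
proof
  assume "reaches A x n"
  then obtain y where y: "n \<le> level y" "(x, y) \<in> A\<^sup>*"
    unfolding reaches_def by blast
  from y(2) obtain x' where "(x, x') \<in> A" "(x', y) \<in> A\<^sup>*"
    using assms(2) y(1) by (cases rule: converse_rtranclE) auto
  then show "(x, x + (1, 0)) \<in> A \<and> reaches A (x + (1, 0)) n \<or>
     (x, x + (0, 1)) \<in> A \<and> reaches A (x + (0, 1)) n"
    using assms(1) y(1) unfolding reaches_def oriented_edges_def by blast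
qed (auto intro: reaches_step)

text \<open>A path of \<open>n\<close> steps scores \<open>n\<close> only if all its edges are open.
  Connectivity thereby inherits the translation invariance of \<open>passage\<close>.\<close>

lemma reaches_iff_passage:
  assumes "A \<subseteq> oriented_edges"
  shows "reaches A x (level x + n) \<longleftrightarrow> passage A n x = n"
proof (induction n arbitrary: x)
  case (Suc n)
  have IH: "reaches A y (level x + Suc n) \<longleftrightarrow> passage A n y = n" if "level y = Suc (level x)" for y
    using Suc[of y] that by simp
  have max: "max (of_bool P + i) (of_bool Q + j) = Suc n \<longleftrightarrow> P \<and> i = n \<or> Q \<and> j = n"
    if "i \<le> n" "j \<le> n" for P Q i j
    using that by (auto simp: max_def of_bool_def)
  have "reaches A x (level x + Suc n) \<longleftrightarrow> (x, x + (1, 0)) \<in> A \<and> passage A n (x + (1, 0)) = n \<or>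
     (x, x + (0, 1)) \<in> A \<and> passage A n (x + (0, 1)) = n"
    using IH[OF edge_level[OF edgeI(1)]] IH[OF edge_level[OF edgeI(2)]]
    by (subst reaches_Suc_iff[OF assms]) (simp_all del: One_nat_def)
  then show ?case
    by (simp only: passage.simps max[OF passage_le passage_le])
qed auto

text \<open>\<open>D\<close> collects the edges that an optimal path for \<open>A\<close> lacks;
  these are what sprinkling has to open.\<close>

lemma passage_fill:
  "\<exists>D \<subseteq> slab (level x + n). card D + passage A n x \<le> n \<and> passage (A \<union> D) n x = n"
proof (induction n arbitrary: x)
  case (Suc n)
  obtain y where y: "(x, y) \<in> oriented_edges" "y = x + (1, 0) \<or> y = x + (0, 1)"
    and eq: "passage A (Suc n) x = of_bool ((x, y) \<in> A) + passage A n y"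
  proof -
    have "\<exists>y. (y = x + (1, 0) \<or> y = x + (0, 1)) \<and>
        passage A (Suc n) x = of_bool ((x, y) \<in> A) + passage A n y"
      by (simp only: passage.simps max_def) metis
    then show ?thesis
      using that edgeI by metis
  qed
  obtain D where D: "D \<subseteq> slab (level y + n)" "card D + passage A n y \<le> n" "passage (A \<union> D) n y = n"
    using Suc[of y] by blast
  define D' where "D' = (if (x, y) \<in> A then D else insert (x, y) D)"
  have fin: "finite D"
    using D(1) by (rule finite_subset) simp
  have "D' \<subseteq> slab (level x + Suc n)"
    using D(1) y(1) edge_level[OF y(1)] by (auto simp: D'_def slab_def)
  moreover have "card D' + passage A (Suc n) x \<le> Suc n"
    using D(2) fin by (auto simp: eq D'_def card_insert_if simp del: passage.simps)
  moreover have "passage (A \<union> D') (Suc n) x = Suc n"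
  proof -
    have "A \<union> D \<subseteq> A \<union> D'"
      by (auto simp: D'_def)
    then have "(x, y) \<in> A \<union> D'" "passage (A \<union> D') n y \<ge> n"
      using D(3) passage_mono[of "A \<union> D" "A \<union> D'" n y] by (auto simp: D'_def)
    then have "of_bool ((x, y) \<in> A \<union> D') + passage (A \<union> D') n y \<ge> Suc n"
      by simp
    then have "passage (A \<union> D') (Suc n) x \<ge> Suc n"
      using y(2) by auto
    then show ?thesis
      using passage_le[of "A \<union> D'" "Suc n" x] by (rule order_antisym[rotated])
  qed
  ultimately show ?case
    by blast
qed (auto intro: exI[of _ "{}"])

definition crossing_prob :: "real \<Rightarrow> nat \<Rightarrow> real" where
  "crossing_prob p n = config_mean p (slab n) (\<lambda>A. of_bool (reaches A 0 n))"

lemma slab_subset: "slab n \<subseteq> oriented_edges"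
  by (auto simp: slab_def)

lemma config_mean_reaches:
  assumes "level x \<le> n" "n \<le> m"
  shows "config_mean p (slab m) (\<lambda>A. of_bool (reaches A x n)) = crossing_prob p (n - level x)"
proof -
  have eq: "config_mean p (slab m) (\<lambda>A. of_bool (reaches A x n)) =
      config_mean p (slab m) (\<lambda>A. of_bool (passage A (n - level x) x = n - level x))"
    if "level x \<le> n" for m n x
  proof (intro config_mean_cong)
    fix A assume "A \<subseteq> slab m"
    then have "reaches A x (level x + (n - level x)) \<longleftrightarrow> passage A (n - level x) x = n - level x"
      using slab_subset by (intro reaches_iff_passage) (rule order_trans)
    then show "of_bool (reaches A x n) = (of_bool (passage A (n - level x) x = n - level x) :: real)"
      using that by simp
  qed
  have "config_mean p (slab m) (\<lambda>A. of_bool (passage A (n - level x) x = n - level x)) =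
      config_mean p (slab (n - level x)) (\<lambda>A. of_bool (passage A (n - level x) 0 = n - level x))"
    using assms by (intro config_mean_passage_vertex) auto
  also have "\<dots> = crossing_prob p (n - level x)"
    using eq[of 0 "n - level x" "n - level x"] by (simp add: crossing_prob_def)
  finally show ?thesis
    using eq assms(1) by simp
qed

lemma crossing_prob_antimono:
  assumes "0 \<le> p" "p \<le> 1" "m \<le> n"
  shows "crossing_prob p n \<le> crossing_prob p m"
proof -
  have "crossing_prob p n \<le> config_mean p (slab n) (\<lambda>A. of_bool (reaches A 0 m))"
    unfolding crossing_prob_def using assms by (intro config_mean_mono) (auto simp: of_bool_def intro: reaches_mono)
  also have "\<dots> = crossing_prob p m"
    using config_mean_reaches[of 0 m n p] assms(3) by simp
  finally show ?thesis .
qed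

lemma crossing_prob_nonneg: "0 \<le> p \<Longrightarrow> p \<le> 1 \<Longrightarrow> 0 \<le> crossing_prob p n"
  unfolding crossing_prob_def by (rule config_mean_nonneg) auto

section \<open>Exits from a finite set and decay of the crossing probabilities\<close>

definition inner_edges :: "(nat \<times> nat) set \<Rightarrow> ((nat \<times> nat) \<times> (nat \<times> nat)) set" where
  "inner_edges S = oriented_edges \<inter> S \<times> S"

definition outer_boundary :: "(nat \<times> nat) set \<Rightarrow> ((nat \<times> nat) \<times> (nat \<times> nat)) set" where
  "outer_boundary S = oriented_edges \<inter> S \<times> (- S)"

text \<open>The expected number of open edges through which the cluster of the origin inside \<open>S\<close> leaves \<open>S\<close>.\<close>

definition phi :: "real \<Rightarrow> (nat \<times> nat) set \<Rightarrow> real" where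
  "phi p S = p * (\<Sum>e\<in>outer_boundary S. config_mean p (inner_edges S) (\<lambda>A. of_bool ((0, fst e) \<in> A\<^sup>*)))"

lemma finite_outer_boundary: "finite S \<Longrightarrow> finite (outer_boundary S)"
  by (rule finite_subset[OF _ finite_oriented_edges_on[of S]]) (auto simp: outer_boundary_def)

text \<open>The exit is the last one because the piece from \<open>y\<close> on then uses only edges
  starting outside \<open>C\<close>. With a cluster as \<open>C\<close>, those edges are independent
  of its exploration.\<close>

lemma rtrancl_last_exit:
  assumes "(a, z) \<in> A\<^sup>*" "a \<in> C" "z \<notin> C"
  shows "\<exists>x y. (x, y) \<in> A \<and> x \<in> C \<and> y \<notin> C \<and> (y, z) \<in> {e \<in> A. fst e \<notin> C}\<^sup>*"
proof -
  from assms(1) have "(a, z) \<in> {e \<in> A. fst e \<notin> C}\<^sup>* \<and> a \<notin> C \<or>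
      (\<exists>x y. (x, y) \<in> A \<and> x \<in> C \<and> y \<notin> C \<and> (y, z) \<in> {e \<in> A. fst e \<notin> C}\<^sup>*)"
  proof (induction rule: converse_rtrancl_induct)
    case (step u v)
    show ?case
    proof (cases "u \<in> C")
      case False
      have "(u, z) \<in> {e \<in> A. fst e \<notin> C}\<^sup>*" if "(v, z) \<in> {e \<in> A. fst e \<notin> C}\<^sup>*"
        using step.hyps(1) False that by (intro converse_rtrancl_into_rtrancl[of u v]) auto
      with step.IH False show ?thesis
        by blast
    qed (use step in blast)
  qed (use assms(3) in blast)
  with assms(2) show ?thesis
    by blast
qed

lemma config_mean_edge:
  assumes "finite E" "e \<in> E"
  shows "config_mean p E (\<lambda>A. of_bool (e \<in> A)) = p"
  using config_mean_subset[of E "{e}" p] assms by simp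

definition cluster :: "(nat \<times> nat) set \<Rightarrow> ((nat \<times> nat) \<times> (nat \<times> nat)) set \<Rightarrow> (nat \<times> nat) set" where
  "cluster S A = {x. (0, x) \<in> (A \<inter> inner_edges S)\<^sup>*}"

lemma cluster_subset:
  assumes "0 \<in> S"
  shows "cluster S A \<subseteq> S"
proof
  fix x assume "x \<in> cluster S A"
  then have "(0, x) \<in> (A \<inter> inner_edges S)\<^sup>*"
    by (simp add: cluster_def)
  then show "x \<in> S"
    using assms by (induction rule: rtrancl_induct) (auto simp: inner_edges_def)
qed

text \<open>Exploring the cluster from the origin queries only edges whose tail has already been
  found. If the result is \<open>c\<close>, edges starting elsewhere were never looked at, so this
  event is independent of them.\<close>

lemma cluster_eq_iff:
  "cluster S A = c \<longleftrightarrow> cluster S (A \<inter> {e \<in> inner_edges S. fst e \<in> c}) = c"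
proof -
  let ?A = "A \<inter> inner_edges S" and ?B = "A \<inter> {e \<in> inner_edges S. fst e \<in> c} \<inter> inner_edges S"
  have sub: "?B\<^sup>* \<subseteq> ?A\<^sup>*"
    by (rule rtrancl_mono) auto
  have A_to_B: "(0, x) \<in> ?B\<^sup>*" if "(0, x) \<in> ?A\<^sup>*" "{x. (0, x) \<in> ?A\<^sup>*} = c \<or> {x. (0, x) \<in> ?B\<^sup>*} = c" for x
    using that(1)
  proof (induction rule: rtrancl_induct)
    case (step u v)
    then have "u \<in> c"
      using that(2) by blast
    then have "(u, v) \<in> ?B"
      using step.hyps(2) by auto
    with step.IH show ?case
      by (rule rtrancl_into_rtrancl)
  qed simp
  then show ?thesis
    unfolding cluster_def using sub by blast
qed

text \<open>A path from the origin to level \<open>n\<close> leaves the cluster of the origin in \<open>S\<close> for the last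
  time through an edge \<open>(x, y)\<close> of the outer boundary of \<open>S\<close>; conditionally on the cluster, the
  remaining piece is independent of the edge and of the past.\<close>

lemma crossing_prob_le_phi:
  assumes p: "0 \<le> p" "p \<le> 1" and S: "finite S" "0 \<in> S" "\<And>x. x \<in> S \<Longrightarrow> level x < l" and l: "l \<le> n"
  shows "crossing_prob p n \<le> phi p S * crossing_prob p (n - l)"
proof -
  let ?off = "\<lambda>c A. {e \<in> A. fst e \<notin> c}"
  have fb: "finite (outer_boundary S)"
    using S(1) by (rule finite_outer_boundary)
  have inner_slab: "inner_edges S \<subseteq> slab n" and outer_slab: "outer_boundary S \<subseteq> slab n"
    using S(3) l by (fastforce simp: inner_edges_def outer_boundary_def slab_def)+
  have exit: "\<exists>e\<in>outer_boundary S. fst e \<in> cluster S A \<and> e \<in> A \<and> reaches (?off (cluster S A) A) (snd e) n"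
    if A: "A \<subseteq> slab n" "reaches A 0 n" for A
  proof -
    obtain z where z: "n \<le> level z" "(0, z) \<in> A\<^sup>*"
      using A(2) unfolding reaches_def by blast
    have "z \<notin> S"
      using S(3) z(1) l by fastforce
    then have "z \<notin> cluster S A" "0 \<in> cluster S A"
      using cluster_subset[OF S(2)] by (auto simp: cluster_def)
    with z(2) obtain x y where xy: "(x, y) \<in> A" "x \<in> cluster S A" "y \<notin> cluster S A"
      "(y, z) \<in> (?off (cluster S A) A)\<^sup>*"
      using rtrancl_last_exit[of 0 z A "cluster S A"] by auto
    have "y \<notin> S"
    proof
      assume "y \<in> S"
      then have "(x, y) \<in> A \<inter> inner_edges S"
        using xy A(1) cluster_subset[OF S(2)] by (auto simp: inner_edges_def slab_def)
      then have "y \<in> cluster S A"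
        using xy(2) unfolding cluster_def by (auto intro: rtrancl_into_rtrancl)
      with xy(3) show False ..
    qed
    then have "(x, y) \<in> outer_boundary S"
      using xy A(1) cluster_subset[OF S(2)] by (auto simp: outer_boundary_def slab_def)
    moreover have "reaches (?off (cluster S A) A) y n"
      using xy(4) z(1) unfolding reaches_def by blast
    ultimately show ?thesis
      using xy(1,2) by force
  qed
  \<comment> \<open>Splitting over the value \<open>c\<close> of the cluster replaces conditioning
    by products of three independent events: the shape of the cluster, the exit edge being open, and
    the connection off \<open>c\<close>.\<close>
  let ?T = "\<lambda>e c A. of_bool (cluster S A = c) * (of_bool (e \<in> A) * of_bool (reaches (?off c A) (snd e) n)) :: real"
  have "crossing_prob p n \<le> config_mean p (slab n) (\<lambda>A. \<Sum>e\<in>outer_boundary S. \<Sum>c | c \<subseteq> S \<and> fst e \<in> c. ?T e c A)"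
    unfolding crossing_prob_def
  proof (intro config_mean_mono p)
    fix A assume A: "A \<subseteq> slab n"
    show "of_bool (reaches A 0 n) \<le> (\<Sum>e\<in>outer_boundary S. \<Sum>c | c \<subseteq> S \<and> fst e \<in> c. ?T e c A)"
    proof (cases "reaches A 0 n")
      case True
      from exit[OF A this] obtain e where e: "e \<in> outer_boundary S" "fst e \<in> cluster S A" "e \<in> A"
        "reaches (?off (cluster S A) A) (snd e) n"
        by blast
      have "1 = ?T e (cluster S A) A"
        using e by simp
      also have "\<dots> \<le> (\<Sum>c | c \<subseteq> S \<and> fst e \<in> c. ?T e c A)"
        using S(1,2) e cluster_subset by (intro member_le_sum) auto
      also have "\<dots> \<le> (\<Sum>e\<in>outer_boundary S. \<Sum>c | c \<subseteq> S \<and> fst e \<in> c. ?T e c A)"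
        using e(1) fb by (intro member_le_sum[where f = "\<lambda>e. \<Sum>c | c \<subseteq> S \<and> fst e \<in> c. ?T e c A"] sum_nonneg) auto
      finally show ?thesis
        using True by simp
    qed (auto intro!: sum_nonneg)
  qed
  also have "\<dots> = (\<Sum>e\<in>outer_boundary S. \<Sum>c | c \<subseteq> S \<and> fst e \<in> c. config_mean p (slab n) (?T e c))"
    by (simp only: config_mean_sum)
  also have "\<dots> \<le> (\<Sum>e\<in>outer_boundary S. \<Sum>c | c \<subseteq> S \<and> fst e \<in> c.
      config_mean p (slab n) (\<lambda>A. of_bool (cluster S A = c)) * (p * crossing_prob p (n - l)))"
  proof (intro sum_mono)
    fix e c assume e: "e \<in> outer_boundary S" and "c \<in> {c. c \<subseteq> S \<and> fst e \<in> c}"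
    then have c: "c \<subseteq> S" "fst e \<in> c"
      by auto
    have lev: "level (snd e) \<le> l"
      using e S(3)[of "fst e"] edge_level[of "fst e" "snd e"] by (auto simp: outer_boundary_def)
    have e': "e \<notin> inner_edges S" "e \<in> slab n"
      using e outer_slab by (auto simp: inner_edges_def outer_boundary_def)
    have "config_mean p (slab n) (?T e c) = config_mean p (slab n) (\<lambda>A. of_bool (cluster S A = c)) *
        config_mean p (slab n) (\<lambda>A. of_bool (e \<in> A) * of_bool (reaches (?off c A) (snd e) n))"
    proof (rule config_mean_indep[where K = "{e \<in> inner_edges S. fst e \<in> c}" and L = "- {e \<in> inner_edges S. fst e \<in> c}"])
      fix A
      have "?off c (A \<inter> - {e \<in> inner_edges S. fst e \<in> c}) = ?off c A"
        by auto
      then show "of_bool (e \<in> A) * of_bool (reaches (?off c A) (snd e) n) =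
          (of_bool (e \<in> A \<inter> - {e \<in> inner_edges S. fst e \<in> c}) *
           of_bool (reaches (?off c (A \<inter> - {e \<in> inner_edges S. fst e \<in> c})) (snd e) n) :: real)"
        using e' by simp
      show "of_bool (cluster S A = c) = (of_bool (cluster S (A \<inter> {e \<in> inner_edges S. fst e \<in> c}) = c) :: real)"
        using cluster_eq_iff[of S A c] by simp
    qed auto
    also have "config_mean p (slab n) (\<lambda>A. of_bool (e \<in> A) * of_bool (reaches (?off c A) (snd e) n)) =
        config_mean p (slab n) (\<lambda>A. of_bool (e \<in> A)) * config_mean p (slab n) (\<lambda>A. of_bool (reaches (?off c A) (snd e) n))"
    proof (rule config_mean_indep[where K = "{e}" and L = "- {e}"])
      fix A
      \<comment> \<open>The exit edge starts in \<open>c\<close>, whereas the remaining path uses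
        only edges starting outside \<open>c\<close>.\<close>
      have "?off c (A \<inter> - {e}) = ?off c A"
        using c by auto
      then show "of_bool (reaches (?off c A) (snd e) n) = (of_bool (reaches (?off c (A \<inter> - {e})) (snd e) n) :: real)"
        by simp
    qed auto
    also have "\<dots> \<le> p * crossing_prob p (n - l)"
    proof -
      have "config_mean p (slab n) (\<lambda>A. of_bool (reaches (?off c A) (snd e) n)) \<le>
          config_mean p (slab n) (\<lambda>A. of_bool (reaches A (snd e) n))"
        using p by (intro config_mean_mono) (auto simp: of_bool_def intro: reaches_mono)
      also have "\<dots> = crossing_prob p (n - level (snd e))"
        using lev l by (intro config_mean_reaches) auto
      also have "\<dots> \<le> crossing_prob p (n - l)"
        using p lev by (intro crossing_prob_antimono) auto
      finally show ?thesis
        using e' p by (simp add: config_mean_edge mult_left_mono)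
    qed
    finally show "config_mean p (slab n) (?T e c) \<le> config_mean p (slab n) (\<lambda>A. of_bool (cluster S A = c)) * (p * crossing_prob p (n - l))"
      using p by (simp add: mult_left_mono config_mean_nonneg)
  qed
  also have "\<dots> = (\<Sum>e\<in>outer_boundary S. config_mean p (inner_edges S) (\<lambda>A. of_bool ((0, fst e) \<in> A\<^sup>*)) * (p * crossing_prob p (n - l)))"
  proof (intro sum.cong refl)
    fix e
    have "(\<Sum>c | c \<subseteq> S \<and> fst e \<in> c. config_mean p (slab n) (\<lambda>A. of_bool (cluster S A = c))) =
        config_mean p (slab n) (\<lambda>A. \<Sum>c | c \<subseteq> S \<and> fst e \<in> c. of_bool (cluster S A = c))"
      by (simp only: config_mean_sum)
    also have "\<dots> = config_mean p (slab n) (\<lambda>A. of_bool ((0, fst e) \<in> (A \<inter> inner_edges S)\<^sup>*))"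
    proof (intro config_mean_cong)
      fix A
      have "(\<Sum>c | c \<subseteq> S \<and> fst e \<in> c. of_bool (cluster S A = c)) =
          (\<Sum>c | c \<subseteq> S \<and> fst e \<in> c. if cluster S A = c then 1 else 0 :: real)"
        by (intro sum.cong) auto
      also have "\<dots> = of_bool (fst e \<in> cluster S A)"
        using S(1) cluster_subset[OF S(2), of A] by (subst sum.delta') auto
      finally show "(\<Sum>c | c \<subseteq> S \<and> fst e \<in> c. of_bool (cluster S A = c)) =
          (of_bool ((0, fst e) \<in> (A \<inter> inner_edges S)\<^sup>*) :: real)"
        by (simp add: cluster_def)
    qed
    also have "\<dots> = config_mean p (inner_edges S) (\<lambda>A. of_bool ((0, fst e) \<in> (A \<inter> inner_edges S)\<^sup>*))"
      using inner_slab by (intro config_mean_superset) (auto simp: Int_assoc)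
    also have "\<dots> = config_mean p (inner_edges S) (\<lambda>A. of_bool ((0, fst e) \<in> A\<^sup>*))"
      by (intro config_mean_cong) (simp add: Int_absorb2)
    finally show "(\<Sum>c | c \<subseteq> S \<and> fst e \<in> c. config_mean p (slab n) (\<lambda>A. of_bool (cluster S A = c)) * (p * crossing_prob p (n - l))) =
        config_mean p (inner_edges S) (\<lambda>A. of_bool ((0, fst e) \<in> A\<^sup>*)) * (p * crossing_prob p (n - l))"
      by (simp flip: sum_distrib_right)
  qed
  also have "\<dots> = phi p S * crossing_prob p (n - l)"
    by (simp add: phi_def sum_distrib_right sum_distrib_left ac_simps)
  finally show ?thesis .
qed

section \<open>The differential inequality for crossing probabilities\<close>

definition unreached :: "nat \<Rightarrow> ((nat \<times> nat) \<times> (nat \<times> nat)) set \<Rightarrow> (nat \<times> nat) set" where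
  "unreached n A = {x. level x < n \<and> \<not> reaches A x n}"

text \<open>Exploration backwards from level \<open>n\<close> queries only edges whose head is
  already known to reach that level. The event that it leaves exactly \<open>S\<close> is thus
  independent of the edges inside \<open>S\<close>.\<close>

lemma unreached_eq_iff:
  "unreached n A = S \<longleftrightarrow> unreached n (A \<inter> {e. snd e \<notin> S}) = S"
proof -
  let ?B = "A \<inter> {e. snd e \<notin> S}"
  have sub: "unreached n A \<subseteq> unreached n ?B"
    by (auto simp: unreached_def intro: reaches_mono)
  have "x \<notin> unreached n ?B" if "unreached n A = S" "x \<notin> S" for x
  proof (cases "level x < n")
    case True
    with that obtain z where z: "n \<le> level z" "(x, z) \<in> A\<^sup>*"
      unfolding unreached_def reaches_def by blast
    from z(2) that(2) have "(x, z) \<in> ?B\<^sup>*"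
    proof (induction rule: converse_rtrancl_induct)
      case (step u v)
      have "reaches A v n"
        using step.hyps(2) z(1) unfolding reaches_def by blast
      then have "v \<notin> S"
        using that(1) by (auto simp: unreached_def)
      then show ?case
        using step by (intro converse_rtrancl_into_rtrancl[of u v]) auto
    qed simp
    then show ?thesis
      using z(1) unfolding unreached_def reaches_def by blast
  qed (simp add: unreached_def)
  moreover have "x \<in> unreached n A" if "unreached n ?B = S" "x \<in> S" for x
  proof (rule ccontr)
    assume "x \<notin> unreached n A"
    with that obtain z where z: "n \<le> level z" "(x, z) \<in> A\<^sup>*"
      unfolding unreached_def reaches_def by blast
    from z(2) have "z \<in> S \<or> reaches ?B x n"
    proof (induction rule: converse_rtrancl_induct)
      case (step u v)
      show ?case
      proof (cases "v \<in> S")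
        case True
        with step.IH that(1) show ?thesis
          by (auto simp: unreached_def)
      next
        case False
        then have "(u, v) \<in> ?B" "reaches ?B v n"
          using step.hyps(1) step.IH that(1) z(1) by (auto simp: unreached_def)
        then show ?thesis
          by (blast intro: reaches_step)
      qed
    qed (use z in blast)
    then show False
      using that z(1) by (auto simp: unreached_def)
  qed
  ultimately show ?thesis
    using sub by blast
qed

text \<open>The head of a boundary edge is outside the unreached set, so it reaches level
  \<open>n\<close> or lies there already; opening the edge joins it to the origin.\<close>

lemma unreached_pivotal:
  assumes "e \<in> outer_boundary (unreached n A)" "(0, fst e) \<in> A\<^sup>*"
  shows "e \<in> slab n" "reaches (insert e A) 0 n"
proof -
  obtain x y where e: "e = (x, y)" "(x, y) \<in> oriented_edges" "level x < n" "n \<le> level y \<or> reaches A y n"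
    using assms(1) by (cases e) (auto simp: outer_boundary_def unreached_def not_less)
  show "e \<in> slab n"
    using e by (simp add: slab_def)
  have "reaches (insert e A) y n"
    using e(4) by (blast intro: reaches_mono)
  with e(1) have "reaches (insert e A) x n"
    by (auto intro: reaches_step[of x y])
  then show "reaches (insert e A) 0 n"
    using assms(2) e(1) rtrancl_mono[of A "insert e A"] by (auto intro!: reaches_rtrancl[of 0 x])
qed

text \<open>The Duminil-Copin--Tassion differential inequality. Given that the origin is unreached, the set
  \<open>S\<close> of unreached vertices is independent of the edges inside \<open>S\<close>, and every edge of its outer
  boundary that the origin can access inside \<open>S\<close> is pivotal.\<close>

lemma crossing_prob_pivotal_ge:
  assumes p: "0 \<le> p" "p \<le> 1" and n: "0 < n"
    and phi: "\<And>S. finite S \<Longrightarrow> 0 \<in> S \<Longrightarrow> 1 \<le> phi p S"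
  shows "1 - crossing_prob p n \<le> (\<Sum>e\<in>slab n. config_mean p (slab n)
    (\<lambda>A. of_bool (reaches (insert e A) 0 n) - of_bool (reaches (A - {e}) 0 n)))"
proof -
  let ?V = "{S. S \<subseteq> {x. level x < n} \<and> 0 \<in> S}"
  let ?P = "\<lambda>S A. of_bool (unreached n A = S) :: real"
  let ?C = "\<lambda>S e A. of_bool ((0, fst e) \<in> (A \<inter> inner_edges S)\<^sup>*) :: real"
  let ?D = "\<lambda>e A. of_bool (reaches (insert e A) 0 n) - of_bool (reaches (A - {e}) 0 n) :: real"
  have finV: "finite ?V"
    using finite_level[of n] by simp
  have finS: "finite S" if "S \<in> ?V" for S
    using that finite_level[of n] by (auto intro: finite_subset)
  \<comment> \<open>The sum picks out the actual unreached set, which belongs to \<open>?V\<close>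
    exactly when the origin does not reach level \<open>n\<close>.\<close>
  have sumP: "(\<Sum>S\<in>?V. ?P S A * h S) = of_bool (\<not> reaches A 0 n) * h (unreached n A)" for A h
  proof -
    have "(\<Sum>S\<in>?V. ?P S A * h S) = (\<Sum>S\<in>?V. if unreached n A = S then h S else 0)"
      by (intro sum.cong) auto
    also have "\<dots> = of_bool (\<not> reaches A 0 n) * h (unreached n A)"
      using n by (subst sum.delta'[OF finV]) (auto simp: unreached_def)
    finally show ?thesis .
  qed
  \<comment> \<open>The factor \<open>p\<close> in \<open>phi\<close> stands for an open exit edge,
    while pivotality does not depend on the state of that edge. Dropping the factor by
    \<open>p \<le> 1\<close> leaves an inequality whose constant is free of
    \<open>p\<close>.\<close>
  have psi: "1 \<le> (\<Sum>e\<in>outer_boundary S. config_mean p (inner_edges S) (\<lambda>A. of_bool ((0, fst e) \<in> A\<^sup>*)))"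
    (is "1 \<le> ?s") if "S \<in> ?V" for S
  proof -
    have "1 \<le> p * ?s"
      using phi[OF finS[OF that]] that by (simp add: phi_def)
    also have "\<dots> \<le> 1 * ?s"
      using p by (intro mult_right_mono sum_nonneg config_mean_nonneg) auto
    finally show ?thesis by simp
  qed
  have "1 - crossing_prob p n = config_mean p (slab n) (\<lambda>A. \<Sum>S\<in>?V. ?P S A * 1)"
    unfolding sumP crossing_prob_def by (simp add: of_bool_not_iff config_mean_diff)
  also have "\<dots> = (\<Sum>S\<in>?V. config_mean p (slab n) (?P S) * 1)"
    by (simp only: config_mean_sum mult_1_right)
  also have "\<dots> \<le> (\<Sum>S\<in>?V. config_mean p (slab n) (?P S) *
      (\<Sum>e\<in>outer_boundary S. config_mean p (inner_edges S) (\<lambda>A. of_bool ((0, fst e) \<in> A\<^sup>*))))"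
    using p psi by (intro sum_mono mult_left_mono config_mean_nonneg) auto
  also have "\<dots> = (\<Sum>S\<in>?V. \<Sum>e\<in>outer_boundary S. config_mean p (slab n) (\<lambda>A. ?P S A * ?C S e A))"
    unfolding sum_distrib_left
  proof (intro sum.cong refl)
    fix S e assume S: "S \<in> ?V"
    have "config_mean p (slab n) (\<lambda>A. ?P S A * ?C S e A) = config_mean p (slab n) (?P S) * config_mean p (slab n) (?C S e)"
    proof (rule config_mean_indep[where K = "{e. snd e \<notin> S}" and L = "inner_edges S"])
      show "?P S A = ?P S (A \<inter> {e. snd e \<notin> S})" for A
        using unreached_eq_iff[of n A S] by simp
    qed (auto simp: inner_edges_def Int_assoc)
    also have "config_mean p (slab n) (?C S e) = config_mean p (inner_edges S) (?C S e)"
      using S by (intro config_mean_superset) (auto simp: Int_assoc inner_edges_def slab_def[of n] intro: finite_slab[unfolded slab_def])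
    also have "\<dots> = config_mean p (inner_edges S) (\<lambda>A. of_bool ((0, fst e) \<in> A\<^sup>*))"
      by (intro config_mean_cong) (simp add: Int_absorb2)
    finally show "config_mean p (slab n) (?P S) * config_mean p (inner_edges S) (\<lambda>A. of_bool ((0, fst e) \<in> A\<^sup>*)) =
        config_mean p (slab n) (\<lambda>A. ?P S A * ?C S e A)"
      by simp
  qed
  also have "\<dots> = config_mean p (slab n) (\<lambda>A. of_bool (\<not> reaches A 0 n) *
      (\<Sum>e\<in>outer_boundary (unreached n A). ?C (unreached n A) e A))"
    by (simp only: sumP flip: config_mean_sum sum_distrib_left)
  also have "\<dots> \<le> config_mean p (slab n) (\<lambda>A. \<Sum>e\<in>slab n. ?D e A)"
  proof (intro config_mean_mono p)
    fix A :: "((nat \<times> nat) \<times> (nat \<times> nat)) set"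
    have D0: "0 \<le> ?D e A" for e
      by (auto simp: of_bool_def intro: reaches_mono)
    show "of_bool (\<not> reaches A 0 n) * (\<Sum>e\<in>outer_boundary (unreached n A). ?C (unreached n A) e A) \<le>
        (\<Sum>e\<in>slab n. ?D e A)"
    proof (cases "reaches A 0 n")
      case False
      have fin: "finite (outer_boundary (unreached n A))"
        using finite_level[of n] by (intro finite_outer_boundary) (auto simp: unreached_def intro: finite_subset)
      have sub: "outer_boundary (unreached n A) \<subseteq> slab n"
        by (auto simp: outer_boundary_def unreached_def slab_def)
      have "(\<Sum>e\<in>outer_boundary (unreached n A). ?C (unreached n A) e A) \<le>
          (\<Sum>e\<in>outer_boundary (unreached n A). ?D e A)"
      proof (intro sum_mono)
        fix e assume e: "e \<in> outer_boundary (unreached n A)"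
        show "?C (unreached n A) e A \<le> ?D e A"
        proof (cases "(0, fst e) \<in> (A \<inter> inner_edges (unreached n A))\<^sup>*")
          case True
          then have "(0, fst e) \<in> A\<^sup>*"
            using rtrancl_mono[of "A \<inter> inner_edges (unreached n A)" A] by blast
          then have "reaches (insert e A) 0 n"
            using unreached_pivotal(2)[OF e] by simp
          moreover have "\<not> reaches (A - {e}) 0 n"
            using False by (auto intro: reaches_mono)
          ultimately show ?thesis
            by simp
        qed (use D0[of e] in simp)
      qed
      also have "\<dots> \<le> (\<Sum>e\<in>slab n. ?D e A)"
        using sub D0 by (intro sum_mono2) auto
      finally show ?thesis
        using False by simp
    qed (use D0 in \<open>auto intro!: sum_nonneg\<close>)
  qed
  finally show ?thesis
    by (simp only: config_mean_sum)
qed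

text \<open>As the derivative is at least \<open>1 - crossing_prob r n\<close>, the product
  \<open>(1 - crossing_prob r n) * exp r\<close> is nonincreasing in \<open>r\<close>. The resulting
  bound does not involve \<open>n\<close>, so it survives the limit to infinite paths.\<close>

lemma crossing_prob_ge:
  assumes pq: "0 \<le> p" "p \<le> q" "q \<le> 1"
    and phi: "\<And>r S. p \<le> r \<Longrightarrow> r \<le> q \<Longrightarrow> finite S \<Longrightarrow> 0 \<in> S \<Longrightarrow> 1 \<le> phi r S"
  shows "1 - exp (p - q) \<le> crossing_prob q n"
proof (cases "n = 0")
  case True
  then have "crossing_prob q n = 1"
    by (simp add: crossing_prob_def reachesI)
  then show ?thesis
    by simp
next
  case False
  define D where "D r = (\<Sum>e\<in>slab n. config_mean r (slab n)
    (\<lambda>A. of_bool (reaches (insert e A) 0 n) - of_bool (reaches (A - {e}) 0 n)))" for r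
  have "(1 - crossing_prob q n) * exp q \<le> (1 - crossing_prob p n) * exp p"
  proof (rule DERIV_nonpos_imp_nonincreasing[OF pq(2)])
    fix r assume r: "p \<le> r" "r \<le> q"
    have "((\<lambda>r. crossing_prob r n) has_real_derivative D r) (at r)"
      unfolding crossing_prob_def D_def by (intro russo_formula) simp
    then have "((\<lambda>r. (1 - crossing_prob r n) * exp r) has_real_derivative
        (1 - crossing_prob r n - D r) * exp r) (at r)"
      by (auto intro!: derivative_eq_intros simp: algebra_simps)
    moreover have "1 - crossing_prob r n \<le> D r"
      unfolding D_def using pq r phi False by (intro crossing_prob_pivotal_ge) auto
    then have "(1 - crossing_prob r n - D r) * exp r \<le> 0"
      by (intro mult_nonpos_nonneg) auto
    ultimately show "\<exists>y. ((\<lambda>r. (1 - crossing_prob r n) * exp r) has_real_derivative y) (at r) \<and> y \<le> 0"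
      by blast
  qed
  also have "\<dots> \<le> exp p"
    using crossing_prob_nonneg[of p n] pq by simp
  finally show ?thesis
    by (simp add: exp_diff field_simps)
qed

section \<open>From speed 1 to crossing probabilities bounded below\<close>

lemma crossing_prob_sprinkle_ge:
  assumes p: "0 \<le> p" "p \<le> 1" and s: "0 < s" "s \<le> 1"
  shows "s powr (real n - mean_passage p n) \<le> crossing_prob (p + (1 - p) * s) n"
proof -
  \<comment> \<open>Given \<open>A\<close>, it is enough that the sprinkled set contains the edges
    \<open>D\<close> missing on an optimal path, which has probability
    \<open>s ^ card D\<close>.\<close>
  have "config_mean s (slab n) (\<lambda>B. of_bool (reaches (A \<union> B) 0 n)) \<ge> s powr (real n - real (passage A n 0))"
    if A: "A \<subseteq> slab n" for A
  proof -
    obtain D where D: "D \<subseteq> slab n" "card D + passage A n 0 \<le> n" "passage (A \<union> D) n 0 = n"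
      using passage_fill[of 0 n A] by auto
    have reach: "reaches (A \<union> B) 0 n" if "D \<subseteq> B" "B \<subseteq> slab n" for B
    proof -
      have "A \<union> D \<subseteq> oriented_edges"
        using A D(1) slab_subset by blast
      then have "reaches (A \<union> D) 0 n"
        using reaches_iff_passage[of "A \<union> D" 0 n] D(3) by simp
      then show ?thesis
        by (rule reaches_mono) (use that in auto)
    qed
    have "s powr (real n - real (passage A n 0)) \<le> s powr real (card D)"
      using s D(2) by (intro powr_mono') auto
    also have "\<dots> = s ^ card D"
      using s by (simp add: powr_realpow)
    also have "\<dots> = config_mean s (slab n) (\<lambda>B. of_bool (D \<subseteq> B))"
      using D(1) by (simp add: config_mean_subset)
    also have "\<dots> \<le> config_mean s (slab n) (\<lambda>B. of_bool (reaches (A \<union> B) 0 n))"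
      using s reach by (intro config_mean_mono) auto
    finally show ?thesis .
  qed
  then have "config_mean p (slab n) (\<lambda>A. s powr (real n - real (passage A n 0))) \<le> crossing_prob (p + (1 - p) * s) n"
    unfolding crossing_prob_def config_mean_sprinkle[OF finite_slab] using p by (intro config_mean_mono)
  moreover have "s powr (real n - mean_passage p n) \<le> config_mean p (slab n) (\<lambda>A. s powr (real n - real (passage A n 0)))"
  proof -
    define c where "c = s powr (real n - mean_passage p n)"
    \<comment> \<open>Jensen's inequality for the convex function
      \<open>\<lambda>x. s powr x\<close>, through its tangent at the mean: the linear term averages
      to 0.\<close>
    have "c = config_mean p (slab n) (\<lambda>A. c * (1 + ln s * (mean_passage p n - real (passage A n 0))))"
      by (simp add: config_mean_cmult config_mean_add config_mean_diff mean_passage_def)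
    also have "\<dots> \<le> config_mean p (slab n) (\<lambda>A. s powr (real n - real (passage A n 0)))"
    proof (intro config_mean_mono p)
      fix A :: "((nat \<times> nat) \<times> (nat \<times> nat)) set"
      have "c * (1 + ln s * (mean_passage p n - real (passage A n 0))) \<le>
          c * exp (ln s * (mean_passage p n - real (passage A n 0)))"
        by (intro mult_left_mono exp_ge_add_one_self) (simp add: c_def)
      also have "\<dots> = s powr (real n - real (passage A n 0))"
        using s by (simp add: c_def powr_def algebra_simps flip: exp_add)
      finally show "c * (1 + ln s * (mean_passage p n - real (passage A n 0))) \<le> s powr (real n - real (passage A n 0))" .
    qed
    finally show ?thesis
      by (simp add: c_def)
  qed
  ultimately show ?thesis
    by linarith
qed

lemma speed_less_1:
  assumes p: "0 \<le> p" "p < r" "r \<le> 1" and S: "finite S" "0 \<in> S" "phi r S < 1"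
  shows "speed p < 1"
proof (rule ccontr)
  assume "\<not> speed p < 1"
  then have v: "(\<lambda>n. mean_passage p n / real n) \<longlonglongrightarrow> 1"
    using speed_le_1[of p] mean_passage_tendsto_speed[of p] p by simp
  define s where "s = (r - p) / (1 - p)"
  have s: "0 < s" "s \<le> 1" "p + (1 - p) * s = r"
    using p by (auto simp: s_def)
  \<comment> \<open>All of \<open>S\<close> lies below level \<open>l\<close>, so every
    \<open>l\<close> levels cost a factor \<open>phi r S\<close>.\<close>
  define l where "l = Suc (Max (level ` S))"
  have l: "level x < l" if "x \<in> S" for x
    using that S(1) by (simp add: l_def le_imp_less_Suc)
  have l0: "0 < l"
    by (simp add: l_def)
  \<comment> \<open>The maximum secures \<open>c > 0\<close>, so that \<open>ln c\<close> can be
    used without a positivity argument for \<open>phi r S\<close>.\<close>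
  define c where "c = max (phi r S) (1 / 2)"
  have c: "0 < c" "c < 1" "phi r S \<le> c"
    using S(3) by (auto simp: c_def)
  have decay: "crossing_prob r (k * l) \<le> c ^ k" for k
  proof (induction k)
    case (Suc k)
    have "crossing_prob r (Suc k * l) \<le> phi r S * crossing_prob r (Suc k * l - l)"
      using p S l by (intro crossing_prob_le_phi) auto
    also have "\<dots> \<le> c * c ^ k"
      using p c Suc by (intro mult_mono) (auto intro: crossing_prob_nonneg)
    finally show ?case by simp
  qed (simp add: crossing_prob_def reachesI)
  \<comment> \<open>Along multiples of \<open>l\<close>, the left side tends to 0 if the speed is 1,
    whereas the right side is a fixed negative number.\<close>
  have ineq: "ln s * (1 - mean_passage p (k * l) / real (k * l)) \<le> ln c / real l" if "k > 0" for k
  proof -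
    have "s powr (real (k * l) - mean_passage p (k * l)) \<le> c ^ k"
      using crossing_prob_sprinkle_ge[of p s "k * l"] p s decay[of k] by simp
    then have "ln (s powr (real (k * l) - mean_passage p (k * l))) \<le> ln (c ^ k)"
      using s c by (subst ln_le_cancel_iff) auto
    then have "(real (k * l) - mean_passage p (k * l)) * ln s \<le> real k * ln c"
      using s c by (simp add: ln_powr ln_realpow)
    then have "(real (k * l) - mean_passage p (k * l)) * ln s / real (k * l) \<le> real k * ln c / real (k * l)"
      by (intro divide_right_mono) auto
    then show ?thesis
      using that l0 by (simp add: field_simps)
  qed
  have "filterlim (\<lambda>k. k * l) sequentially sequentially"
    using l0 by (intro filterlim_subseq) (auto simp: strict_mono_def)
  from filterlim_compose[OF v this]
  have "(\<lambda>k. ln s * (1 - mean_passage p (k * l) / real (k * l))) \<longlonglongrightarrow> ln s * (1 - 1)"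
    by (intro tendsto_intros)
  then have "ln s * (1 - 1) \<le> ln c / real l"
    by (rule LIMSEQ_le_const2) (use ineq in \<open>auto intro!: exI[of _ 1]\<close>)
  moreover have "ln c / real l < 0"
    using c l0 by (intro divide_neg_pos) auto
  ultimately show False
    by simp
qed

lemma speed_1_imp_crossing_prob_ge:
  assumes "0 \<le> p" "p < q" "q \<le> 1" "speed p = 1"
  shows "\<exists>c>0. \<forall>n. c \<le> crossing_prob q n"
proof -
  \<comment> \<open>The midpoint splits the rise: \<open>m > p\<close> leaves room for sprinkling up
    to every \<open>r \<ge> m\<close>, and \<open>m < q\<close> leaves an interval of positive
    length for the integration.\<close>
  define m where "m = (p + q) / 2"
  have m: "p < m" "m < q"
    using assms by (auto simp: m_def)
  have "1 \<le> phi r S" if "m \<le> r" "r \<le> q" "finite S" "0 \<in> S" for r S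
    using speed_less_1[of p r S] that m assms by fastforce
  then have "1 - exp (m - q) \<le> crossing_prob q n" for n
    using m assms by (intro crossing_prob_ge) auto
  moreover have "0 < 1 - exp (m - q)"
    using m by simp
  ultimately show ?thesis
    by blast
qed

section \<open>Bernoulli percolation on a probability space\<close>

lemma (in prob_space) indep_sets_reindex:
  assumes "inj_on h I" "indep_sets F (h ` I)"
  shows "indep_sets (\<lambda>i. F (h i)) I"
proof (rule indep_setsI)
  fix i assume "i \<in> I"
  then show "F (h i) \<subseteq> events"
    using assms(2) by (auto simp: indep_sets_def)
next
  fix A J assume J: "J \<noteq> {}" "J \<subseteq> I" "finite J" "\<forall>j\<in>J. A j \<in> F (h j)"
  have inj: "inj_on h J"
    using assms(1) J(2) by (rule inj_on_subset)
  let ?B = "\<lambda>k. A (inv_into J h k)"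
  have "prob (\<Inter>k\<in>h ` J. ?B k) = (\<Prod>k\<in>h ` J. prob (?B k))"
    using J inj by (intro indep_setsD[OF assms(2)]) auto
  then show "prob (\<Inter>j\<in>J. A j) = (\<Prod>j\<in>J. prob (A j))"
    using inj by (simp add: prod.reindex cong: INF_cong)
qed

lemma (in prob_space) indep_vars_reindex:
  assumes "inj_on h I" "indep_vars N Y (h ` I)"
  shows "indep_vars (\<lambda>i. N (h i)) (\<lambda>i. Y (h i)) I"
  using assms(2) indep_sets_reindex[OF assms(1)]
  unfolding indep_vars_def2 by auto

text \<open>Instantiated for \<open>percolation p\<close> and, from every starting state, for the
  payoffs of the decision process. The two models are compared only through \<open>speed p\<close>,
  which refers to no probability space.\<close>

locale bernoulli_percolation = prob_space M for M :: "'w measure" +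
  fixes X :: "(nat \<times> nat) \<times> (nat \<times> nat) \<Rightarrow> 'w \<Rightarrow> bool" and p :: real
  assumes p: "0 \<le> p" "p \<le> 1"
    and indep: "indep_vars (\<lambda>_. count_space UNIV) X oriented_edges"
    and prob_open: "e \<in> oriented_edges \<Longrightarrow> prob {\<omega> \<in> space M. X e \<omega>} = p"
begin

definition open_edges :: "'w \<Rightarrow> ((nat \<times> nat) \<times> (nat \<times> nat)) set" where
  "open_edges \<omega> = {e \<in> oriented_edges. X e \<omega>}"

lemma open_edges_subset: "open_edges \<omega> \<subseteq> oriented_edges"
  by (auto simp: open_edges_def)

lemma X_measurable: "e \<in> oriented_edges \<Longrightarrow> Measurable.pred M (X e)"
  using indep by (auto simp: indep_vars_def2)

lemma prob_cylinder:
  assumes K: "finite K" "K \<subseteq> oriented_edges" "A \<subseteq> K"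
  shows "{\<omega> \<in> space M. open_edges \<omega> \<inter> K = A} \<in> events"
    and "prob {\<omega> \<in> space M. open_edges \<omega> \<inter> K = A} = p ^ card A * (1 - p) ^ card (K - A)"
proof -
  let ?S = "\<lambda>e. X e -` {e \<in> A} \<inter> space M"
  have S_events: "?S e \<in> events" if "e \<in> K" for e
    using X_measurable[of e] that K(2) by (auto intro: measurable_sets)
  have "prob (?S e) = (if e \<in> A then p else 1 - p)" if "e \<in> K" for e
  proof (cases "e \<in> A")
    case True
    then have "?S e = {\<omega> \<in> space M. X e \<omega>}"
      by auto
    then show ?thesis
      using True prob_open[of e] that K(2) by auto
  next
    case False
    then have "?S e = space M - {\<omega> \<in> space M. X e \<omega>}"
      by auto
    moreover have "{\<omega> \<in> space M. X e \<omega>} \<in> events"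
      using X_measurable[of e] that K(2) by auto
    ultimately show ?thesis
      using False prob_open[of e] that K(2) by (auto simp: prob_compl)
  qed
  then have prod: "(\<Prod>e\<in>K. prob (?S e)) = p ^ card A * (1 - p) ^ card (K - A)"
    using K by (simp add: prod.If_cases Int_absorb1 Diff_eq)
  \<comment> \<open>The empty intersection is \<open>UNIV\<close> and not \<open>space M\<close>,
    hence the case distinction.\<close>
  have eq: "{\<omega> \<in> space M. open_edges \<omega> \<inter> K = A} = (if K = {} then space M else (\<Inter>e\<in>K. ?S e))"
    using K(2,3) by (auto simp: open_edges_def)
  have "(\<Inter>e\<in>K. ?S e) \<in> events" if "K \<noteq> {}"
    using K(1) that S_events by (intro sets.finite_INT)
  then show "{\<omega> \<in> space M. open_edges \<omega> \<inter> K = A} \<in> events"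
    unfolding eq by (metis sets.top)
  show "prob {\<omega> \<in> space M. open_edges \<omega> \<inter> K = A} = p ^ card A * (1 - p) ^ card (K - A)"
  proof (cases "K = {}")
    case True
    then show ?thesis
      unfolding eq using K(3) by (simp add: prob_space)
  next
    case False
    then have "prob (\<Inter>e\<in>K. ?S e) = (\<Prod>e\<in>K. prob (?S e))"
      using K by (intro indep_varsD[OF indep]) auto
    then show ?thesis
      unfolding eq prod[symmetric] using False by simp
  qed
qed

text \<open>The passage from finite sums to probabilities: a local event is a finite disjoint union
  of cylinders.\<close>

lemma prob_local:
  assumes K: "finite K" "K \<subseteq> oriented_edges" and P: "\<And>A. P A = P (A \<inter> K)"
  shows "{\<omega> \<in> space M. P (open_edges \<omega>)} \<in> events"
    and "prob {\<omega> \<in> space M. P (open_edges \<omega>)} = config_mean p K (\<lambda>A. of_bool (P A))"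
proof -
  let ?C = "\<lambda>A. {\<omega> \<in> space M. open_edges \<omega> \<inter> K = A}"
  have eq: "{\<omega> \<in> space M. P (open_edges \<omega>)} = (\<Union>A\<in>{A \<in> Pow K. P A}. ?C A)"
  proof (intro set_eqI)
    fix \<omega>
    show "\<omega> \<in> {\<omega> \<in> space M. P (open_edges \<omega>)} \<longleftrightarrow> \<omega> \<in> (\<Union>A\<in>{A \<in> Pow K. P A}. ?C A)"
      using P[of "open_edges \<omega>"] by auto
  qed
  have fin: "finite {A \<in> Pow K. P A}"
    using K(1) by simp
  show "{\<omega> \<in> space M. P (open_edges \<omega>)} \<in> events"
    unfolding eq using fin prob_cylinder(1)[OF K] by auto
  have "prob (\<Union>A\<in>{A \<in> Pow K. P A}. ?C A) = (\<Sum>A\<in>{A \<in> Pow K. P A}. prob (?C A))"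
    using fin prob_cylinder(1)[OF K] by (intro finite_measure_finite_Union) (auto simp: disjoint_family_on_def)
  also have "\<dots> = (\<Sum>A\<in>{A \<in> Pow K. P A}. p ^ card A * (1 - p) ^ card (K - A) * of_bool (P A))"
    using prob_cylinder(2)[OF K] by (intro sum.cong) auto
  also have "\<dots> = config_mean p K (\<lambda>A. of_bool (P A))"
    unfolding config_mean_def using K(1) by (intro sum.mono_neutral_left) auto
  finally show "prob {\<omega> \<in> space M. P (open_edges \<omega>)} = config_mean p K (\<lambda>A. of_bool (P A))"
    unfolding eq .
qed

text \<open>Borel--Cantelli applies because the deviation bound is geometric in
  \<open>n\<close>.\<close>

lemma AE_passage_near_mean:
  assumes e: "0 < e" "e \<le> 1"
  shows "AE \<omega> in M. \<forall>\<^sub>F n in sequentially.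
    \<bar>real (passage (open_edges \<omega>) n 0) - mean_passage p n\<bar> < e * real n"
proof -
  define P where "P n A \<longleftrightarrow> e * real n \<le> \<bar>real (passage A n 0) - mean_passage p n\<bar>" for n A
  let ?B = "\<lambda>n. {\<omega> \<in> space M. P n (open_edges \<omega>)}"
  have loc: "P n A = P n (A \<inter> slab n)" for n A
    using passage_Int_slab[of 0 n n A] by (simp add: P_def)
  note B = prob_local[where K = "slab n" and P = "P n" for n, OF finite_slab slab_subset loc]
  have "prob (?B n) \<le> 2 * exp (- (e\<^sup>2 / 4)) ^ n" for n
    unfolding B(2) unfolding P_def by (rule passage_deviation[OF p e])
  then have le: "norm (prob (?B n)) \<le> 2 * exp (- (e\<^sup>2 / 4)) ^ n" for n
    by (simp only: real_norm_def abs_of_nonneg[OF measure_nonneg])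
  have "summable (\<lambda>n. 2 * exp (- (e\<^sup>2 / 4)) ^ n)"
    using e by (intro summable_mult summable_geometric) simp
  then have "summable (\<lambda>n. prob (?B n))"
    by (rule summable_comparison_test'[where N = 0]) (rule le)
  then have "AE \<omega> in M. \<forall>\<^sub>F n in sequentially. \<omega> \<in> space M - ?B n"
    using B(1) by (intro borel_cantelli_AE1) (auto simp: emeasure_eq_measure)
  then show ?thesis
    by eventually_elim (auto simp: P_def elim!: eventually_mono)
qed

theorem AE_passage_tendsto_speed:
  "AE \<omega> in M. (\<lambda>n. real (passage (open_edges \<omega>) n 0) / real n) \<longlonglongrightarrow> speed p"
proof -
  have "AE \<omega> in M. \<forall>k. \<forall>\<^sub>F n in sequentially.
      \<bar>real (passage (open_edges \<omega>) n 0) - mean_passage p n\<bar> < 1 / real (Suc k) * real n"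
    unfolding AE_all_countable by (intro allI AE_passage_near_mean) auto
  then show ?thesis
  proof eventually_elim
    fix \<omega>
    assume near: "\<forall>k. \<forall>\<^sub>F n in sequentially.
      \<bar>real (passage (open_edges \<omega>) n 0) - mean_passage p n\<bar> < 1 / real (Suc k) * real n"
    have "(\<lambda>n. real (passage (open_edges \<omega>) n 0) / real n - mean_passage p n / real n) \<longlonglongrightarrow> 0"
    proof (rule tendstoI)
      fix r :: real assume "0 < r"
      then obtain k where k: "1 / real (Suc k) < r"
        using nat_approx_posE by metis
      show "\<forall>\<^sub>F n in sequentially.
          dist (real (passage (open_edges \<omega>) n 0) / real n - mean_passage p n / real n) 0 < r"
        using near[rule_format, of k] eventually_gt_at_top[of 0]
      proof eventually_elim
        fix n :: nat
        assume n: "\<bar>real (passage (open_edges \<omega>) n 0) - mean_passage p n\<bar> < 1 / real (Suc k) * real n" "0 < n"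
        then have "\<bar>real (passage (open_edges \<omega>) n 0) - mean_passage p n\<bar> / real n < 1 / real (Suc k)"
          by (simp add: divide_less_eq)
        then show "dist (real (passage (open_edges \<omega>) n 0) / real n - mean_passage p n / real n) 0 < r"
          using k by (simp add: abs_divide flip: diff_divide_distrib)
      qed
    qed
    from tendsto_add[OF this mean_passage_tendsto_speed[OF p]]
    show "(\<lambda>n. real (passage (open_edges \<omega>) n 0) / real n) \<longlonglongrightarrow> speed p"
      by simp
  qed
qed

end

section \<open>Infinite paths as limits of finite ones\<close>

lemma passage_start_le: "passage A m (x + z) \<le> passage A (level z + m) x"
proof (induction "level z" arbitrary: x z)
  case 0
  then have "z = 0"
    by (cases z) (auto simp: level_def zero_prod_def)
  then show ?case
    by simp
next
  case (Suc k)
  obtain d z' where d: "d = (1, 0) \<or> d = (0, 1)" "z = d + z'" "level z' = k"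
  proof (cases z)
    case (Pair a b)
    show ?thesis
    proof (cases a)
      case 0
      then show ?thesis
        using that[of "(0, 1)" "(0, b - 1)"] Suc.hyps(2) Pair by (simp add: level_def)
    next
      case (Suc a')
      then show ?thesis
        using that[of "(1, 0)" "(a', b)"] Suc.hyps(2) Pair by (simp add: level_def)
    qed
  qed
  have "passage A m (x + z) = passage A m ((x + d) + z')"
    by (simp add: d(2) add.assoc)
  also have "\<dots> \<le> passage A (level z' + m) (x + d)"
    using Suc.hyps(1)[of z'] d(3) by simp
  also have "\<dots> \<le> passage A (Suc (level z' + m)) x"
    using d(1) by auto
  finally show ?case
    by (simp only: d(3) Suc.hyps(2)[symmetric] add_Suc)
qed

text \<open>An infinite path may start at any \<open>z\<close>, but walking there from the origin
  wastes at most \<open>level z\<close> steps, which vanish after division by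
  \<open>n\<close>.\<close>

lemma reaches_all_imp_passage_tendsto:
  assumes "A \<subseteq> oriented_edges" "\<And>n. reaches A z n"
  shows "(\<lambda>n. real (passage A n 0) / real n) \<longlonglongrightarrow> 1"
proof (rule tendsto_sandwich)
  have low: "real n - real (level z) \<le> real (passage A n 0)" for n
  proof (cases "level z \<le> n")
    case True
    then obtain m where m: "n = level z + m"
      using le_Suc_ex by blast
    have "passage A m z = m"
      using assms reaches_iff_passage by blast
    then show ?thesis
      using passage_start_le[of A m 0 z] m by simp
  qed simp
  show "\<forall>\<^sub>F n in sequentially. 1 - real (level z) / real n \<le> real (passage A n 0) / real n"
    using eventually_gt_at_top[of 0]
  proof eventually_elim
    fix n :: nat assume "0 < n"
    then have "1 - real (level z) / real n = (real n - real (level z)) / real n"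
      by (simp add: diff_divide_distrib)
    then show "1 - real (level z) / real n \<le> real (passage A n 0) / real n"
      using low[of n] by (simp add: divide_right_mono)
  qed
  show "\<forall>\<^sub>F n in sequentially. real (passage A n 0) / real n \<le> 1"
    using passage_le by (intro always_eventually) (simp add: divide_le_eq)
  have "(\<lambda>n. 1 - real (level z) / real n) \<longlonglongrightarrow> 1 - 0"
    by (intro tendsto_diff tendsto_const lim_const_over_n)
  then show "(\<lambda>n. 1 - real (level z) / real n) \<longlonglongrightarrow> 1"
    by simp
qed simp

text \<open>The step of Koenig's lemma: \<open>x\<close> has only two possible successors, and if
  each fails at some level, then \<open>x\<close> fails at any level beyond both of these and its
  own.\<close>

lemma reaches_all_step:
  assumes A: "A \<subseteq> oriented_edges" and x: "\<And>n. reaches A x n"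
  shows "\<exists>y. (x, y) \<in> A \<and> (\<forall>n. reaches A y n)"
proof (rule ccontr)
  assume "\<not> ?thesis"
  then obtain f where f: "\<And>y. (x, y) \<in> A \<Longrightarrow> \<not> reaches A y (f y)"
    by metis
  define n where "n = Max {Suc (level x), f (x + (1, 0)), f (x + (0, 1))}"
  have n: "level x < n" "f (x + (1, 0)) \<le> n" "f (x + (0, 1)) \<le> n"
    by (auto simp: n_def Suc_le_eq[symmetric] intro!: Max_ge simp del: Max_insert)
  have "(x, y) \<notin> A \<or> \<not> reaches A y n" if "f y \<le> n" for y
    using f[of y] that reaches_mono[of A y n A "f y"] by auto
  then show False
    using x[of n] reaches_Suc_iff[OF A n(1)] n(2,3) by metis
qed

lemma infinite_open_path_iff_reaches:
  "(\<exists>y. y 0 = x \<and> infinite_open_path \<omega> y) \<longleftrightarrow> (\<forall>n. reaches {e \<in> oriented_edges. \<omega> e} x n)"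
  (is "_ \<longleftrightarrow> (\<forall>n. reaches ?A x n)")
proof
  assume "\<exists>y. y 0 = x \<and> infinite_open_path \<omega> y"
  then obtain y where y: "y 0 = x" "\<And>k. (y k, y (Suc k)) \<in> ?A"
    unfolding infinite_open_path_def by auto
  have "(x, y k) \<in> ?A\<^sup>* \<and> level (y k) = level x + k" for k
  proof (induction k)
    case (Suc k)
    then show ?case
      using y(2)[of k] edge_level[of "y k" "y (Suc k)"] by (auto intro: rtrancl_into_rtrancl)
  qed (simp add: y(1))
  then show "\<forall>n. reaches ?A x n"
    unfolding reaches_def by (metis le_add2)
next
  assume "\<forall>n. reaches ?A x n"
  moreover have "\<exists>z. (\<forall>n. reaches ?A z n) \<and> (y, z) \<in> ?A" if "\<forall>n. reaches ?A y n" for y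
    using reaches_all_step[of ?A y] that by blast
  ultimately have "\<exists>y. \<forall>k. (\<forall>n. reaches ?A (y k) n) \<and> (y 0 = x) \<and> (y k, y (Suc k)) \<in> ?A"
    using dependent_nat_choice[of "\<lambda>k y. (\<forall>n. reaches ?A y n) \<and> (k = 0 \<longrightarrow> y = x)" "\<lambda>k y z. (y, z) \<in> ?A"]
    by (metis (no_types, lifting) nat.distinct(1))
  then show "\<exists>y. y 0 = x \<and> infinite_open_path \<omega> y"
    unfolding infinite_open_path_def by blast
qed

text \<open>A tail of an infinite path is again one. The right-hand side is a countable combination
  of conditions on edges from level \<open>m\<close> on: \<open>m = 0\<close> gives measurability,
  and large \<open>m\<close> gives a tail event.\<close>

lemma infinite_open_path_above:
  "(\<exists>y. infinite_open_path \<omega> y) \<longleftrightarrow> (\<exists>x. m \<le> level x \<and> (\<forall>n. reaches {e \<in> oriented_edges. \<omega> e} x n))"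
proof
  assume "\<exists>y. infinite_open_path \<omega> y"
  then obtain y where y: "infinite_open_path \<omega> y"
    by blast
  have lev: "level (y k) = level (y 0) + k" for k
  proof (induction k)
    case (Suc k)
    then show ?case
      using y edge_level[of "y k" "y (Suc k)"] by (simp add: infinite_open_path_def)
  qed simp
  have "m \<le> level (y m)"
    unfolding lev[of m] by (rule le_add2)
  moreover have "infinite_open_path \<omega> (\<lambda>k. y (k + m))"
    using y by (simp add: infinite_open_path_def)
  then have "\<forall>n. reaches {e \<in> oriented_edges. \<omega> e} (y m) n"
    by (subst infinite_open_path_iff_reaches[symmetric]) (auto intro: exI[of _ "\<lambda>k. y (k + m)"])
  ultimately show "\<exists>x. m \<le> level x \<and> (\<forall>n. reaches {e \<in> oriented_edges. \<omega> e} x n)"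
    by blast
qed (use infinite_open_path_iff_reaches in blast)

text \<open>Measurability is asked only of edges from \<open>level x\<close> on, so that the events
  of \<open>N\<close> may be those generated by all but finitely many edges.\<close>

lemma pred_reaches:
  assumes "\<And>e. e \<in> oriented_edges \<Longrightarrow> level x \<le> level (fst e) \<Longrightarrow> Measurable.pred N (X e)"
  shows "Measurable.pred N (\<lambda>\<omega>. reaches {e \<in> oriented_edges. X e \<omega>} x n)"
  using assms
proof (induction "n - level x" arbitrary: x)
  case 0
  then show ?case
    by (simp add: reachesI)
next
  case (Suc k)
  have lt: "level x < n"
    using Suc.hyps(2) by simp
  have [measurable]: "Measurable.pred N (X (x, x + (1, 0)))" "Measurable.pred N (X (x, x + (0, 1)))"
    using Suc.prems[OF edgeI(1)[of x]] Suc.prems[OF edgeI(2)[of x]] by simp_all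
  have [measurable]: "Measurable.pred N (\<lambda>\<omega>. reaches {e \<in> oriented_edges. X e \<omega>} y n)"
    if "level y = Suc (level x)" for y
    using Suc.hyps(2) that by (intro Suc.hyps(1) Suc.prems) auto
  have "(\<lambda>\<omega>. reaches {e \<in> oriented_edges. X e \<omega>} x n) = (\<lambda>\<omega>.
      X (x, x + (1, 0)) \<omega> \<and> reaches {e \<in> oriented_edges. X e \<omega>} (x + (1, 0)) n \<or>
      X (x, x + (0, 1)) \<omega> \<and> reaches {e \<in> oriented_edges. X e \<omega>} (x + (0, 1)) n)"
    by (intro ext, subst reaches_Suc_iff[OF Collect_restrict lt]) (simp only: mem_Collect_eq edgeI simp_thms)
  moreover have "Measurable.pred N \<dots>"
    by measurable
  ultimately show ?case
    by simp
qed

lemma infinite_oriented_edges: "infinite oriented_edges"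
proof
  assume "finite oriented_edges"
  then have "finite (range (\<lambda>n. ((n, 0 :: nat), (Suc n, 0 :: nat))))"
    by (rule finite_subset[rotated]) (auto simp: oriented_edges_def)
  moreover have "inj (\<lambda>n. ((n, 0 :: nat), (Suc n, 0 :: nat)))"
    by (auto simp: inj_def)
  ultimately show False
    using finite_imageD by blast
qed

context bernoulli_percolation
begin

lemma infinite_path_event:
  "{\<omega> \<in> space M. \<exists>x. infinite_open_path (\<lambda>e. X e \<omega>) x} \<in> events"
proof -
  have [measurable]: "Measurable.pred M (\<lambda>\<omega>. reaches {e \<in> oriented_edges. X e \<omega>} x n)" for x n
    using X_measurable by (intro pred_reaches)
  show ?thesis
    unfolding infinite_open_path_above[of _ 0] by measurable
qed

text \<open>Every infinite open path has a tail that avoids any given finite set of edges, so that the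
  existence of such a path is a tail event.\<close>

lemma prob_infinite_path_0_1:
  "prob {\<omega> \<in> space M. \<exists>x. infinite_open_path (\<lambda>e. X e \<omega>) x} \<in> {0, 1}"
proof -
  \<comment> \<open>The 0-1 law speaks of sequences of \<sigma>-algebras, so the edges are
    enumerated.\<close>
  define en :: "nat \<Rightarrow> (nat \<times> nat) \<times> (nat \<times> nat)" where "en = from_nat_into oriented_edges"
  have bij: "bij_betw en UNIV oriented_edges"
    unfolding en_def using infinite_oriented_edges by (intro bij_betw_from_nat_into) auto
  define F where "F k = sigma_sets (space M) {X (en k) -` B \<inter> space M | B. B \<in> sets (count_space UNIV)}" for k
  have "indep_vars (\<lambda>_. count_space UNIV) (\<lambda>k. X (en k)) UNIV"
    using indep_vars_reindex[of en UNIV "\<lambda>_. count_space UNIV" X] indep bij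
    by (simp add: bij_betw_def)
  then have indep_F: "indep_sets F UNIV"
    unfolding indep_vars_def F_def by simp
  have "sigma_algebra (space M) (F k)" for k
    unfolding F_def by (rule sigma_algebra_sigma_sets) auto
  moreover have "{\<omega> \<in> space M. \<exists>x. infinite_open_path (\<lambda>e. X e \<omega>) x} \<in> tail_events F"
    unfolding tail_events_def
  proof (rule INT_I)
    fix n :: nat
    \<comment> \<open>Every edge starting at level \<open>m\<close> or above has index at least
      \<open>n\<close>. The inserted 0 covers \<open>n = 0\<close>, where the maximum would be over
      the empty set.\<close>
    define m where "m = Suc (Max (insert 0 ((\<lambda>i. level (fst (en i))) ` {..<n})))"
    have m: "level (fst (en i)) < m" if "i < n" for i
      unfolding m_def using that by (intro le_imp_less_Suc Max_ge) auto
    define N where "N = sigma (space M) (\<Union> (F ` {n..}))"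
    have FP: "\<Union> (F ` {n..}) \<subseteq> Pow (space M)"
      using indep_F sets.space_closed[of M] unfolding indep_sets_def by blast
    have N: "space N = space M" "sets N = sigma_sets (space M) (\<Union> (F ` {n..}))"
      unfolding N_def using FP by (auto simp: space_measure_of sets_measure_of)
    have "Measurable.pred N (X e)" if e: "e \<in> oriented_edges" "m \<le> level (fst e)" for e
    proof (rule measurableI)
      fix B :: "bool set"
      obtain k where k: "e = en k"
        using bij e(1) unfolding bij_betw_def by blast
      then have "k \<ge> n"
        using m[of k] e(2) by (cases "n \<le> k") auto
      moreover have "X e -` B \<inter> space M \<in> F k"
        unfolding F_def k by (intro sigma_sets.Basic) auto
      ultimately show "X e -` B \<inter> space N \<in> sets N"
        unfolding N by (intro sigma_sets.Basic) auto
    qed simp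
    then have [measurable]: "Measurable.pred N (\<lambda>\<omega>. reaches {e \<in> oriented_edges. X e \<omega>} x k)"
      if "m \<le> level x" for x k
      using that by (intro pred_reaches) auto
    have "Measurable.pred N (\<lambda>\<omega>. m \<le> level x \<and> (\<forall>k. reaches {e \<in> oriented_edges. X e \<omega>} x k))" for x
      by (cases "m \<le> level x") simp_all
    then have "{\<omega> \<in> space N. \<exists>x. m \<le> level x \<and> (\<forall>k. reaches {e \<in> oriented_edges. X e \<omega>} x k)} \<in> sets N"
      by measurable
    then show "{\<omega> \<in> space M. \<exists>x. infinite_open_path (\<lambda>e. X e \<omega>) x} \<in> sigma_sets (space M) (\<Union> (F ` {n..}))"
      unfolding infinite_open_path_above[of _ m] N .
  qed
  ultimately show ?thesis
    using kolmogorov_0_1_law[OF _ indep_F] by simp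
qed

text \<open>The crossing events decrease with \<open>n\<close>, so their intersection keeps
  probability at least \<open>c\<close>, and the 0-1 law turns positive into 1.\<close>

lemma prob_infinite_path_eq_1I:
  assumes c: "0 < c" "\<And>n. c \<le> crossing_prob p n"
  shows "prob {\<omega> \<in> space M. \<exists>x. infinite_open_path (\<lambda>e. X e \<omega>) x} = 1"
proof -
  let ?U = "\<lambda>n. {\<omega> \<in> space M. reaches (open_edges \<omega>) 0 n}"
  have prob_U: "prob (?U n) = crossing_prob p n" and U: "?U n \<in> events" for n
  proof -
    \<comment> \<open>\<open>prob_local\<close> asks for locality at every set \<open>A\<close>,
      whereas \<open>reaches_Int_slab\<close> speaks of sets of lattice edges; hence the
      intersection.\<close>
    define P where "P A \<longleftrightarrow> reaches (A \<inter> oriented_edges) 0 n" for A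
    have loc: "P A = P (A \<inter> slab n)" for A
      using reaches_Int_slab[of "A \<inter> oriented_edges" n 0] slab_subset[of n]
      by (simp add: P_def Int_ac)
    note L = prob_local[where K = "slab n" and P = P, OF finite_slab slab_subset loc]
    have eq: "P (open_edges \<omega>) \<longleftrightarrow> reaches (open_edges \<omega>) 0 n" for \<omega>
      using open_edges_subset by (simp add: P_def Int_absorb2)
    show "?U n \<in> events"
      using L(1) by (simp add: eq)
    have "config_mean p (slab n) (\<lambda>A. of_bool (P A)) = crossing_prob p n"
      unfolding crossing_prob_def P_def using slab_subset[of n]
      by (intro config_mean_cong) (metis Int_absorb2 order_trans)
    then show "prob (?U n) = crossing_prob p n"
      using L(2) by (simp add: eq)
  qed
  have "(\<lambda>n. prob (?U n)) \<longlonglongrightarrow> prob (\<Inter>n. ?U n)"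
    using U by (intro finite_Lim_measure_decseq) (auto simp: decseq_def intro: reaches_mono)
  then have "c \<le> prob (\<Inter>n. ?U n)"
    by (rule LIMSEQ_le_const) (use c(2) prob_U in auto)
  also have "\<dots> \<le> prob {\<omega> \<in> space M. \<exists>x. infinite_open_path (\<lambda>e. X e \<omega>) x}"
  proof (rule finite_measure_mono[OF _ infinite_path_event])
    show "(\<Inter>n. ?U n) \<subseteq> {\<omega> \<in> space M. \<exists>x. infinite_open_path (\<lambda>e. X e \<omega>) x}"
      unfolding infinite_open_path_above[of _ 0] open_edges_def using le0 by blast
  qed
  finally show ?thesis
    using prob_infinite_path_0_1 c(1) by auto
qed

lemma prob_infinite_path_eq_1D:
  assumes "prob {\<omega> \<in> space M. \<exists>x. infinite_open_path (\<lambda>e. X e \<omega>) x} = 1"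
  shows "speed p = 1"
proof -
  have "AE \<omega> in M. \<exists>x. infinite_open_path (\<lambda>e. X e \<omega>) x"
    using assms infinite_path_event by (simp add: prob_Collect_eq_1)
  with AE_passage_tendsto_speed have "AE \<omega> in M. speed p = 1"
  proof eventually_elim
    fix \<omega>
    assume lim: "(\<lambda>n. real (passage (open_edges \<omega>) n 0) / real n) \<longlonglongrightarrow> speed p"
      and "\<exists>x. infinite_open_path (\<lambda>e. X e \<omega>) x"
    then obtain x where "\<And>n. reaches (open_edges \<omega>) x n"
      unfolding infinite_open_path_above[of _ 0] open_edges_def by blast
    then have "(\<lambda>n. real (passage (open_edges \<omega>) n 0) / real n) \<longlonglongrightarrow> 1"
      using open_edges_subset by (intro reaches_all_imp_passage_tendsto)
    with lim show "speed p = 1"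
      by (rule LIMSEQ_unique)
  qed
  then show ?thesis
    by simp
qed

end

section \<open>The speed and the critical probability\<close>

lemma bernoulli_percolation_percolation:
  assumes "0 \<le> p" "p \<le> 1"
  shows "bernoulli_percolation (percolation p) (\<lambda>e \<omega>. \<omega> e) p"
proof -
  let ?B = "measure_pmf (bernoulli_pmf p)"
  interpret P: prob_space "percolation p"
    unfolding percolation_def by (intro prob_space_PiM measure_pmf.prob_space_axioms)
  have comp: "distr (percolation p) ?B (\<lambda>\<omega>. \<omega> e) = ?B" if "e \<in> oriented_edges" for e
    unfolding percolation_def using that
    by (intro distr_PiM_component measure_pmf.prob_space_axioms)
  have rv: "(\<lambda>\<omega>. \<omega> e) \<in> percolation p \<rightarrow>\<^sub>M ?B" if "e \<in> oriented_edges" for e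
    unfolding percolation_def using that by (rule measurable_component_singleton)
  have "P.indep_vars (\<lambda>_. ?B) (\<lambda>e \<omega>. \<omega> e) oriented_edges"
  proof (subst P.indep_vars_iff_distr_eq_PiM'[OF _ rv])
    have "distr (percolation p) (\<Pi>\<^sub>M e\<in>oriented_edges. ?B) (\<lambda>\<omega>. \<lambda>e\<in>oriented_edges. \<omega> e) =
        distr (percolation p) (percolation p) (\<lambda>\<omega>. \<omega>)"
      by (intro distr_cong) (auto simp: percolation_def space_PiM)
    also have "\<dots> = percolation p"
      by (rule distr_id)
    also have "\<dots> = (\<Pi>\<^sub>M e\<in>oriented_edges. distr (percolation p) ?B (\<lambda>\<omega>. \<omega> e))"
      unfolding percolation_def[of p] by (intro PiM_cong) (simp_all add: comp[unfolded percolation_def])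
    finally show "distr (percolation p) (\<Pi>\<^sub>M e\<in>oriented_edges. ?B) (\<lambda>\<omega>. \<lambda>e\<in>oriented_edges. \<omega> e) =
        (\<Pi>\<^sub>M e\<in>oriented_edges. distr (percolation p) ?B (\<lambda>\<omega>. \<omega> e))" .
    show "oriented_edges \<noteq> {}"
      using infinite_oriented_edges by auto
  qed
  then have "P.indep_vars (\<lambda>_. count_space UNIV) (\<lambda>e \<omega>. \<omega> e) oriented_edges"
    by (rule P.indep_vars_compose2[where Y = "\<lambda>_ b. b"]) simp
  moreover have "P.prob {\<omega> \<in> space (percolation p). \<omega> e} = p" if "e \<in> oriented_edges" for e
  proof -
    have "P.prob {\<omega> \<in> space (percolation p). \<omega> e} = measure (distr (percolation p) ?B (\<lambda>\<omega>. \<omega> e)) {True}"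
      by (subst measure_distr[OF rv[OF that]]) (auto intro: arg_cong[where f = P.prob])
    also have "\<dots> = p"
      unfolding comp[OF that] using assms by (simp add: measure_pmf_single)
    finally show ?thesis .
  qed
  ultimately show ?thesis
    using assms by unfold_locales auto
qed

lemma percolates_imp_speed_1:
  assumes "0 \<le> p" "p \<le> 1"
    and "measure (percolation p) {\<omega> \<in> space (percolation p). \<exists>x. infinite_open_path \<omega> x} = 1"
  shows "speed p = 1"
  using bernoulli_percolation.prob_infinite_path_eq_1D[OF bernoulli_percolation_percolation[OF assms(1,2)]]
    assms(3) by simp

theorem speed_eq_1_iff:
  assumes p: "0 \<le> p" "p \<le> 1"
  shows "speed p = 1 \<longleftrightarrow> critical_probability \<le> p"
proof -
  define C where "C = {p \<in> {0..1}. measure (percolation p)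
     {\<omega> \<in> space (percolation p). \<exists>x. infinite_open_path \<omega> x} = 1}"
  have crit: "critical_probability = Inf C"
    by (simp add: critical_probability_def C_def)
  have bdd: "bdd_below C"
    by (rule bdd_belowI[of _ 0]) (auto simp: C_def)
  have C_I: "q \<in> C" if "0 < c" "\<And>n. c \<le> crossing_prob q n" "0 \<le> q" "q \<le> 1" for q c
    using bernoulli_percolation.prob_infinite_path_eq_1I[OF bernoulli_percolation_percolation[OF that(3,4)] that(1,2)]
      that by (simp add: C_def)
  have "1 \<in> C"
  proof (rule C_I)
    \<comment> \<open>Sprinkling with \<open>s = 1\<close> opens every edge. Membership of 1 makes
      \<open>C\<close> nonempty, as the infimum requires.\<close>
    have "1 powr (real n - mean_passage 0 n) \<le> crossing_prob (0 + (1 - 0) * 1) n" for n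
      by (rule crossing_prob_sprinkle_ge) auto
    then show "1 \<le> crossing_prob 1 n" for n
      by simp
  qed auto
  show ?thesis
  proof
    assume speed: "speed p = 1"
    show "critical_probability \<le> p"
    proof (cases "p = 1")
      case True
      then show ?thesis
        unfolding crit using \<open>1 \<in> C\<close> bdd by (simp add: cInf_lower)
    next
      case False
      show ?thesis
      proof (rule field_le_epsilon)
        fix e :: real assume "0 < e"
        define q where "q = min 1 (p + e)"
        have q: "p < q" "q \<le> 1"
          using False p \<open>0 < e\<close> by (auto simp: q_def)
        then obtain c where "0 < c" "\<And>n. c \<le> crossing_prob q n"
          using speed_1_imp_crossing_prob_ge[OF p(1) _ _ speed] by blast
        then have "q \<in> C"
          using q p by (intro C_I) auto
        then have "critical_probability \<le> q"
          unfolding crit using bdd by (rule cInf_lower)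
        then show "critical_probability \<le> p + e"
          by (simp add: q_def)
      qed
    qed
  next
    assume crit_le: "critical_probability \<le> p"
    \<comment> \<open>The infimum yields some percolating \<open>r < q\<close>. That
      \<open>C\<close> is upward closed has not been shown; monotonicity of the speed takes its
      place.\<close>
    have above: "speed q = 1" if q: "p < q" "q \<le> 1" for q
    proof -
      obtain r where r: "r \<in> C" "r < q"
        using crit_le q(1) \<open>1 \<in> C\<close> bdd unfolding crit by (metis cInf_less_iff empty_iff le_less_trans)
      then have "speed r = 1"
        by (intro percolates_imp_speed_1) (auto simp: C_def)
      moreover have "speed r \<le> speed q"
        using r q by (intro speed_mono) (auto simp: C_def)
      ultimately show ?thesis
        using speed_le_1[of q] p q by simp
    qed
    show "speed p = 1"
    proof (cases "p = 1")
      case False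
      have "1 \<le> speed p"
      proof (rule field_le_epsilon)
        fix e :: real assume "0 < e"
        then obtain d where d: "0 < d" "d \<le> 1" "speed d < e"
          using speed_small by blast
        have "0 < (1 - p) * d" "(1 - p) * d \<le> (1 - p) * 1"
          using p d False by (auto intro!: mult_left_mono)
        then have "p < p + (1 - p) * d" "p + (1 - p) * d \<le> 1"
          by auto
        then have "1 \<le> speed p + speed d"
          using above[of "p + (1 - p) * d"] speed_sprinkle(2)[of p d] p d by simp
        then show "1 \<le> speed p + e"
          using d(3) by simp
      qed
      then show ?thesis
        using speed_le_1[OF p] by simp
    qed simp
  qed
qed

section \<open>The percolation Markov decision process\<close>

context PMDP
begin

text \<open>Bellman recursion for the best total payoff, with \<open>\<omega>\<close> fixed and
  fully known to the player.\<close>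

primrec total_value :: "nat \<Rightarrow> 'w \<Rightarrow> int ^ 'd \<Rightarrow> real" where
  "total_value 0 \<omega> z = 0"
| "total_value (Suc n) \<omega> z = (MAX i\<in>I. g \<omega> z i + total_value n \<omega> (z + i))"

definition path_payoff :: "'w \<Rightarrow> int ^ 'd \<Rightarrow> (nat \<Rightarrow> int ^ 'd) \<Rightarrow> nat \<Rightarrow> real" where
  "path_payoff \<omega> z a n = (\<Sum>m<n. g \<omega> (z + (\<Sum>j<m. a j)) (a m))"

lemma path_payoff_Suc:
  "path_payoff \<omega> z a (Suc n) = g \<omega> z (a 0) + path_payoff \<omega> (z + a 0) (\<lambda>m. a (Suc m)) n"
  by (simp only: path_payoff_def sum.lessThan_Suc_shift) (simp add: add.assoc)

lemma path_payoff_le: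
  assumes "\<And>m. a m \<in> I"
  shows "path_payoff \<omega> z a n \<le> total_value n \<omega> z"
  using assms
proof (induction n arbitrary: z a)
  case (Suc n)
  have "path_payoff \<omega> z a (Suc n) \<le> g \<omega> z (a 0) + total_value n \<omega> (z + a 0)"
    unfolding path_payoff_Suc using Suc by (intro add_left_mono) auto
  also have "\<dots> \<le> total_value (Suc n) \<omega> z"
    using finite_actions Suc.prems by (auto intro!: Max_ge)
  finally show ?case .
qed (simp add: path_payoff_def)

lemma path_payoff_attained:
  "\<exists>a. (\<forall>m. a m \<in> I) \<and> path_payoff \<omega> z a n = total_value n \<omega> z"
proof (induction n arbitrary: z)
  case 0
  obtain i where "i \<in> I"
    using nonempty_actions by blast
  then show ?case
    by (intro exI[of _ "\<lambda>_. i"]) (simp add: path_payoff_def)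
next
  case (Suc n)
  have "total_value (Suc n) \<omega> z \<in> (\<lambda>i. g \<omega> z i + total_value n \<omega> (z + i)) ` I"
    unfolding total_value.simps using finite_actions nonempty_actions by (intro Max_in) auto
  then obtain i where i: "i \<in> I" "total_value (Suc n) \<omega> z = g \<omega> z i + total_value n \<omega> (z + i)"
    by blast
  obtain a where a: "\<And>m. a m \<in> I" "path_payoff \<omega> (z + i) a n = total_value n \<omega> (z + i)"
    using Suc by blast
  have "case_nat i a m \<in> I" for m
    using i(1) a(1) by (cases m) auto
  moreover have "path_payoff \<omega> z (case_nat i a) (Suc n) = total_value (Suc n) \<omega> z"
    unfolding path_payoff_Suc i(2) using a(2) by simp
  ultimately show ?case
    by blast
qed

lemma strategy_in_actions:
  assumes "\<sigma> \<in> strategies" "\<omega> \<in> space M"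
  shows "\<sigma> m \<omega> z \<in> I"
proof -
  have meas: "(\<lambda>(\<omega>, z). \<sigma> m \<omega> z) \<in> F_all \<Otimes>\<^sub>M count_space UNIV \<rightarrow>\<^sub>M count_space I"
    using assms(1) by (simp add: strategies_def)
  have "space F_all = space M"
    unfolding F_all_def by (rule space_measure_of) auto
  then have "(\<omega>, z) \<in> space (F_all \<Otimes>\<^sub>M count_space UNIV)"
    using assms(2) by (simp add: space_pair_measure)
  from measurable_space[OF meas this] show ?thesis
    by simp
qed

lemma payoff_eq_path_payoff:
  "payoff n \<omega> z \<sigma> = path_payoff \<omega> z (\<lambda>m. \<sigma> m \<omega> (state \<sigma> \<omega> z m)) n / real n"
proof -
  have state: "state \<sigma> \<omega> z m = z + (\<Sum>j<m. \<sigma> j \<omega> (state \<sigma> \<omega> z j))" for m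
    by (induction m) (simp_all add: add.assoc)
  show ?thesis
    unfolding payoff_def path_payoff_def by (simp only: state[symmetric])
qed

text \<open>For one fixed \<open>\<omega>\<close> only the actions played matter, and a constant
  decision rule at each stage is already a strategy. Hence no measurable selection of an optimal
  play in \<open>\<omega>\<close> is needed.\<close>

lemma stage_value_eq:
  assumes \<omega>: "\<omega> \<in> space M"
  shows "stage_value n \<omega> z = total_value n \<omega> z / real n"
  unfolding stage_value_def
proof (rule Max_eqI)
  \<comment> \<open>\<open>strategies\<close> may be infinite, but the payoff depends only on the
    first \<open>n\<close> actions, so \<open>Max\<close> is taken over a finite image.\<close>
  have "payoff n \<omega> z ` strategies \<subseteq> (\<lambda>a. path_payoff \<omega> z a n / real n) ` (\<Pi>\<^sub>E m\<in>{..<n}. I)"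
  proof
    fix v assume "v \<in> payoff n \<omega> z ` strategies"
    then obtain \<sigma> where \<sigma>: "\<sigma> \<in> strategies" "v = payoff n \<omega> z \<sigma>"
      by blast
    let ?a = "\<lambda>m. \<sigma> m \<omega> (state \<sigma> \<omega> z m)"
    have "path_payoff \<omega> z ?a n = path_payoff \<omega> z (restrict ?a {..<n}) n"
      unfolding path_payoff_def
    proof (intro sum.cong refl)
      fix m assume m: "m \<in> {..<n}"
      then have "(\<Sum>j<m. ?a j) = (\<Sum>j<m. restrict ?a {..<n} j)"
        by (intro sum.cong) auto
      then show "g \<omega> (z + (\<Sum>j<m. ?a j)) (?a m) =
          g \<omega> (z + (\<Sum>j<m. restrict ?a {..<n} j)) (restrict ?a {..<n} m)"
        using m by simp
    qed
    moreover have "restrict ?a {..<n} \<in> (\<Pi>\<^sub>E m\<in>{..<n}. I)"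
      using strategy_in_actions[OF \<sigma>(1) \<omega>] by auto
    ultimately show "v \<in> (\<lambda>a. path_payoff \<omega> z a n / real n) ` (\<Pi>\<^sub>E m\<in>{..<n}. I)"
      unfolding \<sigma>(2) payoff_eq_path_payoff by (intro image_eqI[of _ _ "restrict ?a {..<n}"]) simp_all
  qed
  then show "finite (payoff n \<omega> z ` strategies)"
    by (rule finite_subset) (auto intro: finite_PiE finite_actions)
next
  fix v assume "v \<in> payoff n \<omega> z ` strategies"
  then show "v \<le> total_value n \<omega> z / real n"
    using strategy_in_actions[OF _ \<omega>]
    by (auto simp: payoff_eq_path_payoff intro!: divide_right_mono path_payoff_le)
next
  obtain a where a: "\<And>m. a m \<in> I" "path_payoff \<omega> z a n = total_value n \<omega> z"
    using path_payoff_attained by blast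
  have "(\<lambda>m _ _. a m) \<in> strategies"
    using a(1) by (auto simp: strategies_def case_prod_beta')
  moreover have "payoff n \<omega> z (\<lambda>m _ _. a m) = total_value n \<omega> z / real n"
    by (simp add: payoff_eq_path_payoff a(2))
  ultimately show "total_value n \<omega> z / real n \<in> payoff n \<omega> z ` strategies"
    by (metis image_eqI)
qed

lemma limit_value_eqI:
  assumes "\<And>z. AE \<omega> in M. (\<lambda>n. stage_value n \<omega> z) \<longlonglongrightarrow> v"
  shows "limit_value = v"
  unfolding limit_value_def
proof (rule the_equality)
  fix v' assume "\<forall>z. AE \<omega> in M. (\<lambda>n. stage_value n \<omega> z) \<longlonglongrightarrow> v'"
  then have "AE \<omega> in M. (\<lambda>n. stage_value n \<omega> 0) \<longlonglongrightarrow> v'"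
    by blast
  with assms[of 0] have "AE \<omega> in M. v' = v"
    by eventually_elim (rule LIMSEQ_unique)
  then show "v' = v"
    by simp
qed (use assms in blast)

end

section \<open>From lattice edges to state-action pairs\<close>

definition lattice_point :: "nat \<times> nat \<Rightarrow> int ^ 2" where
  "lattice_point x = (\<chi> i. if i = 1 then int (fst x) else int (snd x))"

text \<open>The value is an action even for pairs that are no edges, so the facts about payoffs
  apply without an edge condition.\<close>

definition direction :: "(nat \<times> nat) \<times> (nat \<times> nat) \<Rightarrow> int ^ 2" where
  "direction e = (if snd e = fst e + (1, 0) then e1 else e2)"

lemma e1_neq_e2: "e1 \<noteq> e2"
  by (simp add: e1_def e2_def vec_eq_iff forall_2 axis_def)

lemma lattice_point_0: "lattice_point 0 = 0"
  by (simp add: lattice_point_def vec_eq_iff)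

lemma lattice_point_add:
  "lattice_point (x + (1, 0)) = lattice_point x + e1" "lattice_point (x + (0, 1)) = lattice_point x + e2"
  by (simp_all add: lattice_point_def e1_def e2_def vec_eq_iff forall_2 axis_def)

lemma inj_lattice_point: "lattice_point x = lattice_point y \<Longrightarrow> x = y"
  by (cases x; cases y) (simp add: lattice_point_def vec_eq_iff forall_2)

lemma direction_step: "direction (x, x + (1, 0)) = e1" "direction (x, x + (0, 1)) = e2"
  by (cases x; simp add: direction_def)+

text \<open>Distinct edges read distinct payoff variables, so independence of the payoffs passes to
  the edges.\<close>

lemma inj_on_edge:
  "inj_on (\<lambda>e. (z + lattice_point (fst e), direction e)) oriented_edges"
proof (rule inj_onI)
  fix e f
  assume ef: "e \<in> oriented_edges" "f \<in> oriented_edges"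
    and eq: "(z + lattice_point (fst e), direction e) = (z + lattice_point (fst f), direction f)"
  have "fst e = fst f"
    using eq inj_lattice_point by simp
  moreover have "snd e = snd f"
    using ef eq calculation e1_neq_e2 by (auto simp: oriented_edges_def direction_def split: if_splits)
  ultimately show "e = f"
    by (rule prod_eqI)
qed

locale percolation_PMDP = PMDP M "{e1, e2}" g
  for M :: "'w measure" and g :: "'w \<Rightarrow> int ^ 2 \<Rightarrow> int ^ 2 \<Rightarrow> real" +
  fixes p :: real
  assumes p: "0 \<le> p" "p \<le> 1"
    and bernoulli: "i \<in> {e1, e2} \<Longrightarrow>
      distr M borel (\<lambda>\<omega>. g \<omega> z i) = distr (measure_pmf (bernoulli_pmf p)) borel of_bool"
begin

lemma payoff_measurable: "i \<in> {e1, e2} \<Longrightarrow> (\<lambda>\<omega>. g \<omega> z i) \<in> borel_measurable M"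
  using independent_payoffs unfolding indep_vars_def by auto

lemma prob_payoff:
  assumes "i \<in> {e1, e2}" "B \<in> sets borel"
  shows "prob {\<omega> \<in> space M. g \<omega> z i \<in> B} = measure (measure_pmf (bernoulli_pmf p)) {b. of_bool b \<in> B}"
proof -
  have "prob {\<omega> \<in> space M. g \<omega> z i \<in> B} = measure (distr M borel (\<lambda>\<omega>. g \<omega> z i)) B"
    using payoff_measurable[OF assms(1)] assms(2)
    by (subst measure_distr) (auto intro!: arg_cong[where f = prob])
  also have "\<dots> = measure (measure_pmf (bernoulli_pmf p)) {b. of_bool b \<in> B}"
    unfolding bernoulli[OF assms(1)] using assms(2)
    by (subst measure_distr) (auto intro!: arg_cong[where f = "measure _"])
  finally show ?thesis .
qed

text \<open>The payoffs are Bernoulli only in law, so values other than 0 and 1 are excluded only up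
  to a null set.\<close>

lemma AE_payoff_01:
  assumes "i \<in> {e1, e2}"
  shows "AE \<omega> in M. g \<omega> z i \<in> {0, 1}"
proof -
  have "prob {\<omega> \<in> space M. g \<omega> z i \<in> {0, 1}} = 1"
    using measure_pmf.prob_space[of "bernoulli_pmf p"]
    by (subst prob_payoff[OF assms]) (auto simp: of_bool_def)
  then show ?thesis
    using payoff_measurable[OF assms] by (subst (asm) prob_Collect_eq_1) auto
qed

text \<open>An edge is open if its payoff is 1. The quadrant is based at an arbitrary
  \<open>z\<close> because \<open>limit_value\<close> asks for convergence from every starting
  state.\<close>

lemma bernoulli_percolation_from:
  "bernoulli_percolation M (\<lambda>e \<omega>. g \<omega> (z + lattice_point (fst e)) (direction e) = 1) p"
proof
  let ?h = "\<lambda>e. (z + lattice_point (fst e), direction e)"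
  have dir: "direction e \<in> {e1, e2}" for e
    by (simp add: direction_def)
  have "indep_vars (\<lambda>_. count_space UNIV) (\<lambda>zi \<omega>. (case zi of (z, i) \<Rightarrow> \<lambda>\<omega>. g \<omega> z i) \<omega> = 1) (UNIV \<times> {e1, e2})"
    by (rule indep_vars_compose2[OF independent_payoffs, where Y = "\<lambda>_ r. r = 1"]) simp
  then have "indep_vars (\<lambda>_. count_space UNIV) (\<lambda>zi \<omega>. (case zi of (z, i) \<Rightarrow> \<lambda>\<omega>. g \<omega> z i) \<omega> = 1) (?h ` oriented_edges)"
    by (rule indep_vars_subset) (use dir in auto)
  from indep_vars_reindex[OF inj_on_edge this]
  show "indep_vars (\<lambda>_. count_space UNIV) (\<lambda>e \<omega>. g \<omega> (z + lattice_point (fst e)) (direction e) = 1) oriented_edges"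
    by simp
  fix e
  have "{b. (of_bool b :: real) \<in> {1}} = {True}"
    by auto
  then have "prob {\<omega> \<in> space M. g \<omega> (z + lattice_point (fst e)) (direction e) \<in> {1}} = p"
    using p by (subst prob_payoff[OF dir]) (simp_all add: measure_pmf_single)
  then show "prob {\<omega> \<in> space M. g \<omega> (z + lattice_point (fst e)) (direction e) = 1} = p"
    by simp
qed (use p in auto)

lemma total_value_eq_passage:
  assumes "\<And>e. e \<in> oriented_edges \<Longrightarrow> g \<omega> (z + lattice_point (fst e)) (direction e) \<in> {0, 1}"
  shows "total_value n \<omega> (z + lattice_point x) =
    real (passage {e \<in> oriented_edges. g \<omega> (z + lattice_point (fst e)) (direction e) = 1} n x)"
    (is "_ = real (passage ?A n x)")
proof (induction n arbitrary: x)
  case (Suc n)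
  have g: "g \<omega> (z + lattice_point x) (direction (x, y)) = of_bool ((x, y) \<in> ?A)"
    if "(x, y) \<in> oriented_edges" for y
    using assms[OF that] that by auto
  have "total_value (Suc n) \<omega> (z + lattice_point x) =
      max (g \<omega> (z + lattice_point x) e1 + total_value n \<omega> (z + lattice_point (x + (1, 0))))
          (g \<omega> (z + lattice_point x) e2 + total_value n \<omega> (z + lattice_point (x + (0, 1))))"
    by (simp only: total_value.simps image_insert image_empty lattice_point_add add.assoc) simp
  also have "\<dots> = max (real (of_bool ((x, x + (1, 0)) \<in> ?A) + passage ?A n (x + (1, 0))))
      (real (of_bool ((x, x + (0, 1)) \<in> ?A) + passage ?A n (x + (0, 1))))"
    using g[OF edgeI(1)] g[OF edgeI(2)] by (simp only: Suc direction_step of_nat_add of_nat_of_bool)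
  also have "\<dots> = real (passage ?A (Suc n) x)"
    by (simp only: passage.simps of_nat_max)
  finally show ?case .
qed simp

lemma limit_value_eq_speed: "limit_value = speed p"
proof (rule limit_value_eqI)
  fix z
  interpret B: bernoulli_percolation M "\<lambda>e \<omega>. g \<omega> (z + lattice_point (fst e)) (direction e) = 1" p
    by (rule bernoulli_percolation_from)
  have "AE \<omega> in M. \<forall>e. e \<in> oriented_edges \<longrightarrow> g \<omega> (z + lattice_point (fst e)) (direction e) \<in> {0, 1}"
    unfolding AE_all_countable using AE_payoff_01 by (auto simp: direction_def)
  with B.AE_passage_tendsto_speed AE_space
  show "AE \<omega> in M. (\<lambda>n. stage_value n \<omega> z) \<longlonglongrightarrow> speed p"
  proof eventually_elim
    fix \<omega>
    assume lim: "(\<lambda>n. real (passage (B.open_edges \<omega>) n 0) / real n) \<longlonglongrightarrow> speed p"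
      and \<omega>: "\<omega> \<in> space M"
      and g01: "\<forall>e. e \<in> oriented_edges \<longrightarrow> g \<omega> (z + lattice_point (fst e)) (direction e) \<in> {0, 1}"
    have "total_value n \<omega> z = real (passage (B.open_edges \<omega>) n 0)" for n
      using total_value_eq_passage[OF g01[rule_format], of n 0] by (simp add: lattice_point_0 B.open_edges_def)
    then show "(\<lambda>n. stage_value n \<omega> z) \<longlonglongrightarrow> speed p"
      using lim by (simp add: stage_value_eq[OF \<omega>])
  qed
qed

end

theorem theorem5p3:
  fixes M :: "'w measure"
    and g :: "'w \<Rightarrow> int ^ 2 \<Rightarrow> int ^ 2 \<Rightarrow> real"
    and p :: real
  assumes "p \<in> {0..1}"
    and "PMDP M {e1, e2} g"
    and "\<And>z i. i \<in> {e1, e2} \<Longrightarrow>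
      distr M borel (\<lambda>\<omega>. g \<omega> z i) = distr (measure_pmf (bernoulli_pmf p)) borel of_bool"
  shows "PMDP.limit_value M {e1, e2} g = 1 \<longleftrightarrow> p \<ge> critical_probability"
proof -
  interpret PMDP M "{e1, e2}" g
    by fact
  interpret percolation_PMDP M g p
    using assms by unfold_locales auto
  show ?thesis
    using speed_eq_1_iff[OF p] by (simp add: limit_value_eq_speed)
qed

end
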